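(* Assume $\sigma$-projective determinacy. Then every Menger space that is a continuous image of a $\sigma$-projective set is $\sigma$-compact.
   Context: Spaces are completely regular. $\sigma$-projective sets: sets of reals in $\mathbf{\Sigma}^1_{\omega_1}$ of the transfinite projective hierarchy ($\mathbf{\Sigma}^1_1$ analytic; $\mathbf{\Pi}^1_\xi$ complements of $\mathbf{\Sigma}^1_\xi$; $\mathbf{\Sigma}^1_{\xi+1}$ continuous images of $\mathbf{\Pi}^1_\xi$; at limits, countable unions of earlier levels). $\sigma$-projective determinacy: all length-$\omega$ perfect-information games on $\omega$ with $\sigma$-projective payoff are determined. Menger: for every sequence $(\mathcal{U}_n)$ of open covers there are finite $\mathcal{V}_n\subseteq\mathcal{U}_n$ with $\bigcup_n\mathcal{V}_n$ a cover. *)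

theory Defs
  imports "HOL-Analysis.Analysis"
begin

text \<open>Reals are the points of the Baire space, that is, of the type \<^typ>\<open>nat \<Rightarrow> nat\<close> with
  the product topology provided by its type class instance.\<close>

type_synonym baire = "nat \<Rightarrow> nat"

definition analytic_set :: "baire set \<Rightarrow> bool" where
  "analytic_set A \<longleftrightarrow> A = {} \<or> (\<exists>f :: baire \<Rightarrow> baire. continuous_on UNIV f \<and> A = range f)"

abbreviation omega1 :: "nat set rel" where
  "omega1 \<equiv> cardSuc natLeq"

text \<open>The element \<open>\<xi>\<close> of \<^term>\<open>Field omega1\<close> stands for the level \<open>1 + \<xi>\<close>: the least element
  indexes the analytic sets, and at infinite \<open>\<xi>\<close> there is no shift.\<close>

definition is_zero1 :: "nat set \<Rightarrow> bool" where
  "is_zero1 \<xi> \<longleftrightarrow> \<xi> \<in> Field omega1 \<and> underS omega1 \<xi> = {}"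

definition succ1 :: "nat set \<Rightarrow> nat set" where
  "succ1 \<xi> = wo_rel.suc omega1 {\<xi>}"

definition is_limit1 :: "nat set \<Rightarrow> bool" where
  "is_limit1 \<eta> \<longleftrightarrow> \<eta> \<in> Field omega1 \<and> \<not> is_zero1 \<eta> \<and> (\<forall>\<xi> \<in> Field omega1. \<eta> \<noteq> succ1 \<xi>)"

inductive Sigma1 :: "nat set \<Rightarrow> baire set \<Rightarrow> bool"
  and Pi1 :: "nat set \<Rightarrow> baire set \<Rightarrow> bool"
where
  Sigma1_zero: "is_zero1 \<xi> \<Longrightarrow> analytic_set A \<Longrightarrow> Sigma1 \<xi> A"
| Pi1_compl: "Sigma1 \<xi> A \<Longrightarrow> Pi1 \<xi> (- A)"
| Sigma1_succ: "Pi1 \<xi> A \<Longrightarrow> continuous_on A f \<Longrightarrow> Sigma1 (succ1 \<xi>) (f ` A)"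
| Sigma1_limit: "is_limit1 \<eta> \<Longrightarrow> (\<And>n :: nat. \<xi> n \<in> underS omega1 \<eta> \<and> Sigma1 (\<xi> n) (A n))
    \<Longrightarrow> Sigma1 \<eta> (\<Union>n. A n)"

text \<open>Level \<open>\<omega>\<^sub>1\<close> itself, given by the limit clause applied to all the levels below.\<close>

definition sigma_projective :: "baire set \<Rightarrow> bool" where
  "sigma_projective A \<longleftrightarrow>
     (\<exists>B :: nat \<Rightarrow> baire set. (\<forall>n. \<exists>\<xi> \<in> Field omega1. Sigma1 \<xi> (B n)) \<and> A = (\<Union>n. B n))"

text \<open>In the game with payoff \<open>A\<close>, player I plays \<open>x 0, x 2, \<dots>\<close>, player II plays
  \<open>x 1, x 3, \<dots>\<close>, and player I wins the run \<open>x\<close> iff \<open>x \<in> A\<close>. A strategy maps the finite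
  sequence of all previous moves to the next move.\<close>

definition follows_I :: "(nat list \<Rightarrow> nat) \<Rightarrow> baire \<Rightarrow> bool" where
  "follows_I s x \<longleftrightarrow> (\<forall>n. x (2 * n) = s (map x [0..<2 * n]))"

definition follows_II :: "(nat list \<Rightarrow> nat) \<Rightarrow> baire \<Rightarrow> bool" where
  "follows_II s x \<longleftrightarrow> (\<forall>n. x (2 * n + 1) = s (map x [0..<2 * n + 1]))"

definition determined :: "baire set \<Rightarrow> bool" where
  "determined A \<longleftrightarrow>
     (\<exists>s. \<forall>x. follows_I s x \<longrightarrow> x \<in> A) \<or> (\<exists>s. \<forall>x. follows_II s x \<longrightarrow> x \<notin> A)"

definition sigma_projective_determinacy :: bool where
  "sigma_projective_determinacy \<longleftrightarrow> (\<forall>A. sigma_projective A \<longrightarrow> determined A)"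

definition open_cover :: "'a topology \<Rightarrow> 'a set set \<Rightarrow> bool" where
  "open_cover X \<U> \<longleftrightarrow> (\<forall>U \<in> \<U>. openin X U) \<and> \<Union>\<U> = topspace X"

definition Menger_space :: "'a topology \<Rightarrow> bool" where
  "Menger_space X \<longleftrightarrow>
     (\<forall>\<U> :: nat \<Rightarrow> 'a set set. (\<forall>n. open_cover X (\<U> n)) \<longrightarrow>
        (\<exists>\<V>. (\<forall>n. finite (\<V> n) \<and> \<V> n \<subseteq> \<U> n) \<and> \<Union>(\<Union>n. \<V> n) = topspace X))"

definition sigma_compact_space :: "'a topology \<Rightarrow> bool" where
  "sigma_compact_space X \<longleftrightarrow>
     (\<exists>K :: nat \<Rightarrow> 'a set. (\<forall>n. compactin X (K n)) \<and> (\<Union>n. K n) = topspace X)"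

definition continuous_image_of :: "'a topology \<Rightarrow> baire set \<Rightarrow> bool" where
  "continuous_image_of X A \<longleftrightarrow>
     (\<exists>f. continuous_map (top_of_set A) X f \<and> f ` A = topspace X)"

end

theory Submission
  imports Defs
begin

text \<open>
  Let \<open>f\<close> map the \<open>\<sigma>\<close>-projective set \<open>A\<close> continuously onto the Menger space \<open>X\<close>. The images under
  \<open>f\<close> of the basic clopen sets form a countable network of \<open>X\<close>, and regularity separates
  network elements by countably many open sets \<open>W p\<close> with closed supersets \<open>C p\<close>. A real \<open>z\<close> codes
  \<open>x\<close> if, for all \<open>p\<close>, \<open>z p = 0\<close> implies \<open>x \<notin> W p\<close> and \<open>z p \<noteq> 0\<close> implies \<open>x \<in> C p\<close>; a code determines
  its point up to topological indistinguishability, and the set \<open>Z\<close> of all codes is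
  \<open>\<sigma>\<close>-projective. Consider the Wadge game in which player I builds \<open>z\<close>, player II builds \<open>v\<close>, and I
  wins iff \<open>z \<in> Z\<close> is equivalent to \<open>v\<close> having infinitely many nonzero entries.

  A winning strategy of I turns into a winning strategy of the first player in the Menger game
  on \<open>X\<close>, which is impossible in a Menger space by a theorem of Hurewicz. A winning strategy of II
  exhibits \<open>Z\<close> as a countable union of closed sets. Then \<open>X\<close> is, up to indistinguishability, a
  countable union of continuous images of closed subsets of the Baire space, and by an argument of
  Hurewicz and Arhangel'skii such images inside a Menger space are covered by countably many
  compact sets.
\<close>

section \<open>Cylinders of the Baire space\<close>

definition cyl :: "nat list \<Rightarrow> baire set" where
  "cyl s = {x. map x [0..<length s] = s}"

lemma in_cyl_iff: "x \<in> cyl s \<longleftrightarrow> (\<forall>i<length s. x i = s ! i)"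
  unfolding cyl_def list_eq_iff_nth_eq by simp

lemma in_cyl_map [simp]: "x \<in> cyl (map x [0..<n])"
  by (simp add: in_cyl_iff)

lemma in_cyl_mapD: "x \<in> cyl (map y [0..<n]) \<Longrightarrow> i < n \<Longrightarrow> x i = y i"
  by (simp add: in_cyl_iff)

lemma open_coordinate: "open {x :: baire. P (x i)}"
proof -
  have "open ((\<lambda>x :: baire. x i) -` Collect P)"
    by (intro open_vimage open_discrete continuous_on_product_coordinates)
  then show ?thesis by (simp add: vimage_def)
qed

lemma closed_coordinate: "closed {x :: baire. P (x i)}"
  using open_coordinate[of "\<lambda>a. \<not> P a" i] by (simp add: closed_def Collect_neg_eq)

lemma open_cyl: "open (cyl s)"
proof -
  have "cyl s = (\<Inter>i<length s. {x. x i = s ! i})"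
    by (auto simp: in_cyl_iff)
  then show ?thesis
    by (auto intro!: open_INT open_coordinate)
qed

lemma open_contains_cyl:
  assumes "open U" "x \<in> U"
  obtains n where "cyl (map x [0..<n]) \<subseteq> U"
proof -
  have "openin (product_topology (\<lambda>i::nat. euclidean :: nat topology) UNIV) U"
    using assms(1) by (simp add: open_fun_def)
  then obtain Y where Y: "x \<in> Pi\<^sub>E UNIV Y" "finite {i. Y i \<noteq> topspace (euclidean :: nat topology)}"
      "Pi\<^sub>E UNIV Y \<subseteq> U"
    using product_topology_open_contains_basis[OF _ assms(2)] by blast
  obtain n where n: "\<And>i. Y i \<noteq> UNIV \<Longrightarrow> i < n"
    using finite_nat_set_iff_bounded Y(2) by auto
  have "cyl (map x [0..<n]) \<subseteq> U"
  proof
    fix y assume "y \<in> cyl (map x [0..<n])"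
    then have "y i \<in> Y i" for i
      using Y(1) n[of i] in_cyl_mapD[of y x n i] by (cases "i < n") (auto simp: PiE_iff)
    then show "y \<in> U" using Y(3) by (auto simp: PiE_iff)
  qed
  then show thesis by (rule that)
qed

lemma open_eq_Union_cyl:
  assumes "open U"
  shows "U = \<Union>(cyl ` {s. cyl s \<subseteq> U})"
proof
  show "U \<subseteq> \<Union>(cyl ` {s. cyl s \<subseteq> U})"
  proof
    fix x assume "x \<in> U"
    then obtain n where "cyl (map x [0..<n]) \<subseteq> U" by (rule open_contains_cyl[OF assms])
    then show "x \<in> \<Union>(cyl ` {s. cyl s \<subseteq> U})" using in_cyl_map by blast
  qed
qed auto

text \<open>Gives the real produced by a play whose positions \<open>q n\<close> are finite
  sequences that grow at every round.\<close>

lemma chain_in_cyl: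
  assumes "\<And>n. \<exists>r. r \<noteq> [] \<and> q (Suc n) = q n @ r"
  obtains y where "\<And>n. y \<in> cyl (q n)" "\<And>n. n \<le> length (q n)"
proof -
  have len: "n \<le> length (q n)" for n
  proof (induction n)
    case (Suc n)
    then show ?case using assms[of n] by (auto simp: Suc_le_eq length_greater_0_conv[symmetric] simp del: length_greater_0_conv)
  qed simp
  have ext: "\<exists>r. q m = q n @ r" if "n \<le> m" for n m
    using that
  proof (induction m rule: dec_induct)
    case (step m)
    then show ?case using assms[of m] by auto
  qed simp
  have "q n ! i = q m ! i" if "i < length (q n)" "i < length (q m)" for i n m
    using ext[of n m] ext[of m n] that by (cases "n \<le> m") (auto simp: nth_append)
  \<comment> \<open>Entry \<open>i\<close> is read off at stage \<open>Suc i\<close>, whose length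
    is guaranteed to exceed \<open>i\<close>.\<close>
  then have "(\<lambda>i. q (Suc i) ! i) \<in> cyl (q n)" for n
    unfolding in_cyl_iff using len Suc_le_lessD by blast
  then show thesis using len by (rule that)
qed

section \<open>Coding pairs of reals, and a Lipschitz criterion for continuity\<close>

definition evens :: "baire \<Rightarrow> baire" where "evens x = (\<lambda>i. x (2 * i))"
definition odds :: "baire \<Rightarrow> baire" where "odds x = (\<lambda>i. x (2 * i + 1))"
definition interleave :: "baire \<Rightarrow> baire \<Rightarrow> baire" where
  "interleave x y = (\<lambda>i. if even i then x (i div 2) else y (i div 2))"

lemma evens_interleave [simp]: "evens (interleave x y) = x"
  and odds_interleave [simp]: "odds (interleave x y) = y"
  by (auto simp: evens_def odds_def interleave_def)

lemma continuous_on_evens [continuous_intros]: "continuous_on S evens"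
  and continuous_on_odds [continuous_intros]: "continuous_on S odds"
proof -
  have "continuous_on S (\<lambda>x :: baire. x i)" for i
    by (rule continuous_on_subset[OF continuous_on_product_coordinates subset_UNIV])
  then show "continuous_on S evens" "continuous_on S odds"
    unfolding evens_def[abs_def] odds_def[abs_def]
    by (auto intro: continuous_on_coordinatewise_then_product)
qed

text \<open>The Lipschitz condition for the first-difference metric is what a strategy
  provides.\<close>

lemma continuous_on_baireI:
  fixes f :: "baire \<Rightarrow> baire"
  assumes "\<And>x y k i. \<forall>j<k. x j = y j \<Longrightarrow> i < k \<Longrightarrow> f x i = f y i"
  shows "continuous_on UNIV f"
proof (rule continuous_on_coordinatewise_then_product)
  fix i
  have "open ((\<lambda>x. f x i) -` B)" for B
  proof (subst open_subopen, intro ballI)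
    fix x assume x: "x \<in> (\<lambda>x. f x i) -` B"
    have "cyl (map x [0..<Suc i]) \<subseteq> (\<lambda>x. f x i) -` B"
    proof
      fix y assume "y \<in> cyl (map x [0..<Suc i])"
      then have "f y i = f x i"
        using assms[of "Suc i" y x i] lessI[of i] in_cyl_mapD[of y x "Suc i"] by blast
      then show "y \<in> (\<lambda>x. f x i) -` B" using x by simp
    qed
    then show "\<exists>T. open T \<and> x \<in> T \<and> T \<subseteq> (\<lambda>x. f x i) -` B"
      using open_cyl in_cyl_map by blast
  qed
  then show "continuous_on UNIV (\<lambda>x. f x i)"
    by (simp add: continuous_on_open_vimage)
qed

section \<open>Countable cofinality in the first uncountable ordinal\<close>

unbundle cardinal_syntax

lemma omega1_Card_order: "Card_order omega1"
  by (rule cardSuc_Card_order[OF natLeq_Card_order])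

lemma omega1_wo_rel: "wo_rel omega1"
  using card_order_on_well_order_on[OF omega1_Card_order] by (simp add: wo_rel_def)

lemma countable_iff_le_natLeq: "countable A \<longleftrightarrow> |A| \<le>o natLeq"
proof -
  have "countable A \<longleftrightarrow> |A| \<le>o |UNIV :: nat set|"
    by (simp add: countable_def card_of_ordLeq[symmetric])
  then show ?thesis
    using card_of_nat ordIso_symmetric ordLeq_ordIso_trans by blast
qed

text \<open>Otherwise the field would be a countable union of initial segments, each countable,
  against \<open>omega1\<close> being the successor cardinal of \<open>natLeq\<close>.\<close>

lemma countable_AboveS_omega1:
  assumes "countable S" "S \<subseteq> Field omega1"
  shows "AboveS omega1 S \<noteq> {}"
proof
  assume empty: "AboveS omega1 S = {}"
  have "countable (under omega1 s)" if "s \<in> S" for s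
  proof -
    have s: "s \<in> Field omega1" using that assms by blast
    have "|underS omega1 s| <o omega1"
      using card_of_underS[OF omega1_Card_order s] .
    then have "|underS omega1 s| \<le>o natLeq"
      using cardSuc_ordLess_ordLeq[OF natLeq_Card_order card_of_Card_order] 
      by (metis cardSuc_ordLeq_ordLess card_of_Card_order natLeq_Card_order)
    then have "countable (underS omega1 s)"
      by (simp add: countable_iff_le_natLeq)
    moreover have "under omega1 s \<subseteq> insert s (underS omega1 s)"
      by (auto simp: under_def underS_def)
    ultimately show ?thesis by (meson countable_insert countable_subset)
  qed
  then have "countable (\<Union>s\<in>S. under omega1 s)" using assms by blast
  moreover have "Field omega1 \<subseteq> (\<Union>s\<in>S. under omega1 s)"
  proof
    fix x assume x: "x \<in> Field omega1"
    then obtain s where s: "s \<in> S" "x = s \<or> (s, x) \<notin> omega1"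
      using empty unfolding AboveS_def by blast
    then have "(x, s) \<in> omega1"
      using wo_rel.TOTALS[OF omega1_wo_rel] x assms(2) by blast
    then show "x \<in> (\<Union>s\<in>S. under omega1 s)" using s by (auto simp: under_def)
  qed
  ultimately have "countable (Field omega1)" using countable_subset by blast
  then have "|Field omega1| \<le>o natLeq" by (simp add: countable_iff_le_natLeq)
  then have "omega1 \<le>o natLeq"
    using card_of_Field_ordIso[OF omega1_Card_order] ordIso_ordLeq_trans ordIso_symmetric by blast
  then show False
    using cardSuc_greater[OF natLeq_Card_order] not_ordLess_ordLeq by blast
qed

lemma succ1_greater:
  assumes "\<xi> \<in> Field omega1"
  shows "succ1 \<xi> \<in> Field omega1" "\<xi> \<in> underS omega1 (succ1 \<xi>)"
proof -
  have "AboveS omega1 {\<xi>} \<noteq> {}" using assms by (intro countable_AboveS_omega1) auto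
  then show "succ1 \<xi> \<in> Field omega1" "\<xi> \<in> underS omega1 (succ1 \<xi>)"
    using assms wo_rel.suc_inField[OF omega1_wo_rel, of "{\<xi>}"]
      wo_rel.suc_greater[OF omega1_wo_rel, of "{\<xi>}" \<xi>]
    by (auto simp: succ1_def underS_def)
qed

lemma succ1_least:
  assumes "\<xi> \<in> underS omega1 \<eta>"
  shows "(succ1 \<xi>, \<eta>) \<in> omega1"
  unfolding succ1_def
  by (rule wo_rel.suc_least_AboveS[OF omega1_wo_rel])
     (use assms in \<open>auto simp: AboveS_def underS_def Field_def\<close>)

text \<open>Take the supremum of the closure of all \<open>\<xi> n\<close> under
  \<open>succ1\<close>. A predecessor of it would lie at or below some member \<open>s\<close> of
  the closure, which puts the supremum at or below the member \<open>succ1 s\<close>. A limit is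
  wanted because the hierarchy takes unions only there.\<close>

lemma exists_limit1_above:
  fixes \<xi> :: "nat \<Rightarrow> nat set"
  assumes "\<And>n. \<xi> n \<in> Field omega1"
  obtains \<eta> where "is_limit1 \<eta>" "\<And>n. \<xi> n \<in> underS omega1 \<eta>"
proof -
  note wo = omega1_wo_rel
  have antisym: "a = b" if "(a, b) \<in> omega1" "(b, a) \<in> omega1" for a b
    using wo_rel.ANTISYM[OF wo] that by (auto dest: antisymD)
  have trans: "(a, c) \<in> omega1" if "(a, b) \<in> omega1" "(b, c) \<in> omega1" for a b c
    using wo_rel.TRANS[OF wo] that by (auto dest: transD)
  define S where "S = (\<Union>n. range (\<lambda>m. (succ1 ^^ m) (\<xi> n)))"
  have S_Field: "S \<subseteq> Field omega1"
  proof -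
    have "(succ1 ^^ m) (\<xi> n) \<in> Field omega1" for m n
      by (induction m) (auto simp: assms intro: succ1_greater)
    then show ?thesis by (auto simp: S_def)
  qed
  have S_succ: "succ1 s \<in> S" if s: "s \<in> S" for s
  proof -
    obtain n m where "s = (succ1 ^^ m) (\<xi> n)" using s by (auto simp: S_def)
    then have "succ1 s = (succ1 ^^ Suc m) (\<xi> n)" by simp
    then show ?thesis unfolding S_def by blast
  qed
  have \<xi>_S: "\<xi> n \<in> S" for n
    unfolding S_def by (rule UN_I[of n]) (auto intro: image_eqI[where x = 0])
  have ne: "AboveS omega1 S \<noteq> {}"
    by (rule countable_AboveS_omega1[OF _ S_Field]) (auto simp: S_def)
  define \<eta> where "\<eta> = wo_rel.suc omega1 S"
  have \<eta>_Field: "\<eta> \<in> Field omega1"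
    unfolding \<eta>_def using wo_rel.suc_inField[OF wo S_Field ne] .
  have below: "s \<in> underS omega1 \<eta>" if "s \<in> S" for s
    using wo_rel.suc_greater[OF wo S_Field ne that] by (auto simp: \<eta>_def underS_def)
  have "is_limit1 \<eta>"
    unfolding is_limit1_def
  proof (intro conjI ballI)
    show "\<not> is_zero1 \<eta>" using below[OF \<xi>_S] by (auto simp: is_zero1_def)
  next
    fix \<zeta> assume \<zeta>: "\<zeta> \<in> Field omega1"
    show "\<eta> \<noteq> succ1 \<zeta>"
    proof
      assume eq: "\<eta> = succ1 \<zeta>"
      have lt: "\<zeta> \<in> underS omega1 \<eta>" using succ1_greater(2)[OF \<zeta>] eq by simp
      have "\<zeta> \<notin> AboveS omega1 S"
        using wo_rel.suc_least_AboveS[OF wo, of \<zeta> S] lt antisym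
        by (auto simp: \<eta>_def underS_def)
      then obtain s where s: "s \<in> S" "\<zeta> = s \<or> (s, \<zeta>) \<notin> omega1"
        using \<zeta> by (auto simp: AboveS_def)
      then have "(\<zeta>, s) \<in> omega1"
        using wo_rel.TOTALS[OF wo] \<zeta> S_Field by blast
      then have "\<zeta> \<in> underS omega1 (succ1 s)"
        using succ1_greater(2)[of s] s(1) S_Field trans antisym
        unfolding underS_def by blast
      then have "(\<eta>, succ1 s) \<in> omega1" using succ1_least eq by simp
      then show False using below[OF S_succ[OF s(1)]] antisym by (auto simp: underS_def)
    qed
  qed (rule \<eta>_Field)
  then show thesis using that below \<xi>_S by blast
qed

lemma exists_zero1: "\<exists>\<xi>. is_zero1 \<xi>"
proof -
  define \<xi> where "\<xi> = wo_rel.suc omega1 {}"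
  have ne: "AboveS omega1 {} \<noteq> {}" by (rule countable_AboveS_omega1) auto
  have "\<xi> \<in> Field omega1"
    unfolding \<xi>_def using wo_rel.suc_inField[OF omega1_wo_rel _ ne] by simp
  moreover have "underS omega1 \<xi> = {}"
  proof -
    have False if "a \<in> underS omega1 \<xi>" for a
    proof -
      have "a \<in> AboveS omega1 {}" using that by (auto simp: AboveS_def underS_def Field_def)
      then have "(\<xi>, a) \<in> omega1"
        unfolding \<xi>_def by (rule wo_rel.suc_least_AboveS[OF omega1_wo_rel])
      then show False using that wo_rel.ANTISYM[OF omega1_wo_rel]
        by (auto simp: underS_def dest: antisymD)
    qed
    then show ?thesis by blast
  qed
  ultimately show ?thesis by (auto simp: is_zero1_def)
qed

section \<open>Closure properties of the transfinite projective hierarchy\<close>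

text \<open>The union of all countable levels, so that closure properties can be proved without
  tracking indices; it will turn out to consist exactly of the sigma-projective sets.\<close>

definition projective_class :: "baire set set" where
  "projective_class = {A. \<exists>\<xi>. Sigma1 \<xi> A}"

lemma Sigma1_Field: "Sigma1 \<xi> A \<Longrightarrow> \<xi> \<in> Field omega1"
  and Pi1_Field: "Pi1 \<xi> A \<Longrightarrow> \<xi> \<in> Field omega1"
  by (induction rule: Sigma1_Pi1.inducts)
     (auto simp: is_zero1_def is_limit1_def intro: succ1_greater)

lemma analytic_set_in_projective_class: "analytic_set A \<Longrightarrow> A \<in> projective_class"
  using exists_zero1 Sigma1_zero by (auto simp: projective_class_def)

lemma Pi1_in_projective_class: "Pi1 \<xi> A \<Longrightarrow> A \<in> projective_class"
  using Sigma1_succ[of \<xi> A id] by (auto simp: projective_class_def)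

lemma projective_class_compl: "A \<in> projective_class \<Longrightarrow> - A \<in> projective_class"
  unfolding projective_class_def using Pi1_compl Pi1_in_projective_class[unfolded projective_class_def] by blast

lemma projective_class_UN:
  fixes A :: "nat \<Rightarrow> baire set"
  assumes "\<And>n. A n \<in> projective_class"
  shows "(\<Union>n. A n) \<in> projective_class"
proof -
  obtain \<xi> where \<xi>: "\<And>n. Sigma1 (\<xi> n) (A n)"
    using assms unfolding projective_class_def mem_Collect_eq by metis
  then obtain \<eta> where "is_limit1 \<eta>" "\<And>n. \<xi> n \<in> underS omega1 \<eta>"
    using exists_limit1_above[of \<xi>] Sigma1_Field by blast
  then have "Sigma1 \<eta> (\<Union>n. A n)" using \<xi> by (intro Sigma1_limit) auto
  then show ?thesis by (auto simp: projective_class_def)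
qed

lemma empty_in_projective_class: "{} \<in> projective_class"
  by (rule analytic_set_in_projective_class) (simp add: analytic_set_def)

lemma sigma_algebra_projective_class: "sigma_algebra UNIV projective_class"
  unfolding sigma_algebra_iff2
  using empty_in_projective_class projective_class_compl projective_class_UN
  by (auto simp: Compl_eq_Diff_UNIV[symmetric] image_subset_iff)

interpretation projective: sigma_algebra UNIV projective_class
  by (rule sigma_algebra_projective_class)

lemma sigma_projective_iff: "sigma_projective A \<longleftrightarrow> A \<in> projective_class"
proof
  assume "sigma_projective A"
  then obtain B :: "nat \<Rightarrow> baire set"
    where B: "\<forall>n. \<exists>\<xi>\<in>Field omega1. Sigma1 \<xi> (B n)" and A: "A = (\<Union>n. B n)"
    unfolding sigma_projective_def by (elim exE conjE)
  have "B n \<in> projective_class" for n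
    using B[rule_format, of n] by (auto simp: projective_class_def)
  then show "A \<in> projective_class" unfolding A by (rule projective_class_UN)
next
  assume "A \<in> projective_class"
  then obtain \<xi> where "Sigma1 \<xi> A" by (auto simp: projective_class_def)
  then show "sigma_projective A"
    unfolding sigma_projective_def using Sigma1_Field[of \<xi> A]
    by (intro exI[of _ "\<lambda>_. A"] conjI allI bexI[of _ \<xi>]) simp_all
qed

lemma analytic_cyl: "analytic_set (cyl s)"
proof -
  \<comment> \<open>A continuous retraction of the Baire space onto the cylinder.\<close>
  let ?f = "\<lambda>x :: baire. \<lambda>i. if i < length s then s ! i else x i"
  have "continuous_on UNIV ?f"
    by (rule continuous_on_baireI) auto
  moreover have "cyl s = range ?f"
  proof
    show "cyl s \<subseteq> range ?f"
    proof
      fix x assume "x \<in> cyl s"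
      then have "x = ?f x" by (auto simp: in_cyl_iff)
      then show "x \<in> range ?f" by blast
    qed
  qed (auto simp: in_cyl_iff)
  ultimately show ?thesis by (auto simp: analytic_set_def)
qed

lemma open_in_projective_class:
  assumes "open U"
  shows "U \<in> projective_class"
proof -
  have "(\<Union>s\<in>{s. cyl s \<subseteq> U}. cyl s) \<in> projective_class"
    by (rule projective.countable_UN'')
       (auto intro: analytic_set_in_projective_class analytic_cyl)
  then show ?thesis using open_eq_Union_cyl[OF assms] by simp
qed

lemma closed_in_projective_class: "closed F \<Longrightarrow> F \<in> projective_class"
  using open_in_projective_class[of "- F"] projective_class_compl[of "- F"] by auto

text \<open>At a successor level \<open>g\<close> is absorbed into the continuous map that defines
  the set, so the mutual induction carries only a trivial claim for \<open>Pi1\<close>.\<close>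

lemma projective_class_image_aux:
  "Sigma1 \<xi> A \<Longrightarrow> continuous_on A g \<Longrightarrow> g ` A \<in> projective_class"
  "Pi1 \<xi> A \<Longrightarrow> True"
proof (induction arbitrary: g rule: Sigma1_Pi1.inducts)
  case (Sigma1_zero \<xi> A)
  have "analytic_set (g ` A)"
  proof (cases "A = {}")
    case False
    then obtain f :: "baire \<Rightarrow> baire" where f: "continuous_on UNIV f" "A = range f"
      using Sigma1_zero by (auto simp: analytic_set_def)
    then have "continuous_on UNIV (g \<circ> f)"
      using Sigma1_zero by (intro continuous_on_compose) auto
    moreover have "g ` A = range (g \<circ> f)" using f by (simp add: image_comp)
    ultimately show ?thesis unfolding analytic_set_def by blast
  qed (simp add: analytic_set_def)
  then show ?case by (rule analytic_set_in_projective_class)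
next
  case (Sigma1_succ \<xi> A f)
  then have "continuous_on A (g \<circ> f)" by (intro continuous_on_compose)
  then have "Sigma1 (succ1 \<xi>) ((g \<circ> f) ` A)"
    using Sigma1_succ by (intro Sigma1_Pi1.Sigma1_succ)
  then show ?case by (auto simp: projective_class_def image_comp)
next
  case (Sigma1_limit \<eta> \<xi> A)
  then have "g ` A n \<in> projective_class" for n
    by (meson UN_upper UNIV_I continuous_on_subset)
  then have "(\<Union>n. g ` A n) \<in> projective_class" by (rule projective_class_UN)
  then show ?case by (simp add: image_UN)
qed auto

lemma projective_class_image:
  "A \<in> projective_class \<Longrightarrow> continuous_on A g \<Longrightarrow> g ` A \<in> projective_class"
  using projective_class_image_aux unfolding projective_class_def by blast

text \<open>A real \<open>x\<close> lies in the preimage iff some \<open>b\<close> in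
  \<open>B\<close> has \<open>f b = h x\<close>. The interleaved pairs of such \<open>b\<close> and
  \<open>x\<close> form a relatively closed subset of the \<open>evens\<close>-preimage of
  \<open>B\<close>, and \<open>odds\<close> projects it onto the preimage.\<close>

lemma projective_class_vimage_image:
  fixes f h :: "baire \<Rightarrow> baire"
  assumes B: "evens -` B \<in> projective_class"
    and f: "continuous_on B f" and h: "continuous_on UNIV h"
  shows "h -` f ` B \<in> projective_class"
proof -
  let ?S = "evens -` B"
  define T where "T = {w \<in> ?S. f (evens w) = h (odds w)}"
  have "continuous_on ?S (\<lambda>w. f (evens w))"
    by (rule continuous_on_compose2[OF f continuous_on_evens]) auto
  moreover have "continuous_on ?S (\<lambda>w. h (odds w))"
    by (rule continuous_on_compose2[OF h continuous_on_odds]) auto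
  \<comment> \<open>Equality of two reals is tested one coordinate at a time, as a closed condition
    on pairs of naturals.\<close>
  ultimately have "continuous_on ?S (\<lambda>w. (f (evens w) i, h (odds w) i))" for i
    by (intro continuous_on_Pair) (auto dest: continuous_on_product_then_coordinatewise)
  moreover have "closed {p :: nat \<times> nat. fst p = snd p}"
    by (intro closed_Collect_eq continuous_on_fst continuous_on_snd continuous_on_id)
  ultimately have "closedin (top_of_set ?S)
      (?S \<inter> (\<lambda>w. (f (evens w) i, h (odds w) i)) -` {p. fst p = snd p})" for i
    by (rule continuous_closedin_preimage)
  then have "closedin (top_of_set ?S)
      (\<Inter>i. ?S \<inter> (\<lambda>w. (f (evens w) i, h (odds w) i)) -` {p. fst p = snd p})"
    by (intro closedin_INT) auto
  also have "\<dots> = T"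
    by (auto simp: T_def)
  finally have "closedin (top_of_set ?S) T" .
  then obtain F where F: "closed F" "T = ?S \<inter> F"
    by (auto simp: closedin_closed)
  then have "T \<in> projective_class"
    using B closed_in_projective_class by auto
  then have "odds ` T \<in> projective_class"
    by (intro projective_class_image continuous_on_odds)
  moreover have "odds ` T = h -` f ` B"
  proof
    show "h -` f ` B \<subseteq> odds ` T"
    proof
      fix x assume "x \<in> h -` f ` B"
      then obtain b where "b \<in> B" "h x = f b" by auto
      then have "interleave b x \<in> T" by (simp add: T_def)
      then show "x \<in> odds ` T" by (metis imageI odds_interleave)
    qed
  qed (auto simp: T_def dest: sym)
  ultimately show ?thesis by simp
qed

text \<open>The successor case feeds the induction hypothesis for the \<open>Pi1\<close> set, taken
  at \<open>h = evens\<close>, into the preceding lemma; hence the generalization over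
  \<open>h\<close>.\<close>

lemma projective_class_vimage_aux:
  "Sigma1 \<xi> A \<Longrightarrow> continuous_on UNIV h \<Longrightarrow> h -` A \<in> projective_class"
  "Pi1 \<xi> A \<Longrightarrow> continuous_on UNIV h \<Longrightarrow> h -` A \<in> projective_class"
proof (induction arbitrary: h and h rule: Sigma1_Pi1.inducts)
  case (Sigma1_zero \<xi> A)
  show ?case
  proof (cases "A = {}")
    case False
    then obtain f :: "baire \<Rightarrow> baire" where "continuous_on UNIV f" "A = f ` UNIV"
      using Sigma1_zero by (auto simp: analytic_set_def)
    then show ?thesis
      using projective_class_vimage_image[of UNIV f h] Sigma1_zero projective.top by simp
  qed (simp add: empty_in_projective_class)
next
  case (Pi1_compl \<xi> A)
  then show ?case by (simp add: vimage_Compl projective_class_compl)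
next
  case (Sigma1_succ \<xi> A f)
  then show ?case
    by (intro projective_class_vimage_image) (auto intro: continuous_on_evens)
next
  case (Sigma1_limit \<eta> \<xi> A)
  then have "(\<Union>n. h -` A n) \<in> projective_class" by (intro projective_class_UN) auto
  then show ?case by (simp add: vimage_UN)
qed

lemma projective_class_vimage:
  "A \<in> projective_class \<Longrightarrow> continuous_on UNIV h \<Longrightarrow> h -` A \<in> projective_class"
  using projective_class_vimage_aux unfolding projective_class_def by blast

section \<open>The Menger game\<close>

text \<open>A finite part of an increasing cover is contained in a single member, so a Menger
  selection amounts to a function \<open>g\<close>.\<close>

lemma Menger_space_increasing:
  fixes W :: "nat \<Rightarrow> nat \<Rightarrow> 'a set"
  assumes "Menger_space X"
    and op: "\<And>n k. openin X (W n k)"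
    and mono: "\<And>n. mono (W n)"
    and cov: "\<And>n. (\<Union>k. W n k) = topspace X"
  obtains g where "\<And>x. x \<in> topspace X \<Longrightarrow> \<exists>n. x \<in> W n (g n)"
proof -
  have "\<forall>n. open_cover X (range (W n))"
    using op cov by (auto simp: open_cover_def)
  then have "\<exists>\<V>. (\<forall>n. finite (\<V> n) \<and> \<V> n \<subseteq> range (W n)) \<and> \<Union>(\<Union>n. \<V> n) = topspace X"
    by (rule assms(1)[unfolded Menger_space_def, THEN spec, of "\<lambda>n. range (W n)", THEN mp])
  then obtain \<V> where \<V>: "\<And>n. finite (\<V> n) \<and> \<V> n \<subseteq> range (W n)" "\<Union>(\<Union>n. \<V> n) = topspace X"
    by (elim exE conjE) blast
  have "\<exists>k. \<Union>(\<V> n) \<subseteq> W n k" for n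
  proof -
    obtain I where I: "finite I" "\<V> n = W n ` I"
      using finite_subset_image[of "\<V> n" "W n" UNIV] \<V>(1) by blast
    then obtain k where "\<And>i. i \<in> I \<Longrightarrow> i \<le> k" using finite_nat_set_iff_bounded_le[of I] by blast
    then have "\<Union>(\<V> n) \<subseteq> W n k" using I monoD[OF mono[of n]] by blast
    then show ?thesis ..
  qed
  then obtain g where "\<And>n. \<Union>(\<V> n) \<subseteq> W n (g n)" by metis
  then show thesis
    using \<V>(2) by (intro that[of g]) blast
qed

lemma Menger_space_countable_subcover:
  assumes "Menger_space X" "open_cover X \<U>"
  obtains \<V> where "countable \<V>" "\<V> \<subseteq> \<U>" "\<Union>\<V> = topspace X"
proof -
  have "\<exists>\<V>. (\<forall>n :: nat. finite (\<V> n) \<and> \<V> n \<subseteq> \<U>) \<and> \<Union>(\<Union>n. \<V> n) = topspace X"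
    using assms(1)[unfolded Menger_space_def, THEN spec, of "\<lambda>_. \<U>"] assms(2) by simp
  then obtain \<V> :: "nat \<Rightarrow> 'a set set" where "\<And>n. finite (\<V> n) \<and> \<V> n \<subseteq> \<U>" "\<Union>(\<Union>n. \<V> n) = topspace X"
    by (elim exE conjE) blast
  then show thesis
    by (intro that[of "\<Union>n. \<V> n"]) (auto intro: countable_finite)
qed

text \<open>Hurewicz's theorem: the first player, who answers the position \<open>s\<close> with the increasing cover
  \<open>U s\<close>, has no winning strategy. Enlarging \<open>U s k\<close> to \<open>E s k\<close> by everything covered on the way to \<open>s\<close>
  makes finitely many positions decide membership in the sets of all positions of a given length,
  so that the strategy collapses to a single sequence of open covers.\<close>

lemma Menger_space_game_lists:
  fixes U :: "nat list \<Rightarrow> nat \<Rightarrow> 'a set"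
  assumes "Menger_space X"
    and op: "\<And>s k. openin X (U s k)"
    and mono: "\<And>s. mono (U s)"
    and cov: "\<And>s. (\<Union>k. U s k) = topspace X"
  obtains g where "\<And>x. x \<in> topspace X \<Longrightarrow> \<exists>n. x \<in> U (map g [0..<n]) (g n)"
proof -
  define E where "E s k = U s k \<union> (\<Union>i<length s. U (take i s) (s ! i))" for s k
  define L where "L n k = {s :: nat list. set s \<subseteq> {..<k} \<and> length s \<le> n}" for n k
  define V where "V n k = (\<Inter>s\<in>L n k. E s k)" for n k
  have L: "finite (L n k)" "[] \<in> L n k" for n k
    by (auto simp: L_def intro: finite_lists_length_le)
  have "openin X (V n k)" for n k
    unfolding V_def using L[of n k]
    by (intro openin_INT2) (auto simp: E_def intro!: openin_Un op openin_Union)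
  \<comment> \<open>Induction on the number of remaining moves. A next move above \<open>k0\<close>
    already puts \<open>x\<close> into the set played at \<open>t\<close>; the finitely many moves
    up to \<open>k0\<close> are handled by the maximum of their bounds.\<close>
  have uniform: "\<exists>k. \<forall>k'\<ge>k. \<forall>s. length s = n \<longrightarrow> x \<in> E (t @ s) k'" if x: "x \<in> topspace X" for x n t
  proof (induction n arbitrary: t)
    case 0
    obtain k where "x \<in> U t k" using cov x by blast
    then show ?case using monoD[OF mono[of t], of k] unfolding E_def by (intro exI[of _ k]) auto
  next
    case (Suc n)
    obtain k0 where k0: "x \<in> U t k0" using cov x by blast
    obtain K where K: "\<And>j k' s. K j \<le> k' \<Longrightarrow> length s = n \<Longrightarrow> x \<in> E ((t @ [j]) @ s) k'"
    proof -
      have "\<forall>j. \<exists>k. \<forall>k'\<ge>k. \<forall>s. length s = n \<longrightarrow> x \<in> E ((t @ [j]) @ s) k'"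
        using Suc.IH by blast
      then show thesis using that by (auto dest!: choice)
    qed
    have "x \<in> E (t @ s) k'" if k': "Max (K ` {..k0}) \<le> k'" and s: "length s = Suc n" for k' s
    proof -
      obtain j r where r: "s = j # r" "length r = n" using s by (cases s) auto
      show ?thesis
      proof (cases "j \<le> k0")
        case True
        then have "K j \<le> k'" using k' by (meson Max_ge atMost_iff finite_atMost finite_imageI image_eqI order_trans)
        then show ?thesis using K[of j k' r] r by simp
      next
        case False
        then have "x \<in> U t j" using k0 monoD[OF mono[of t], of k0 j] by auto
        then have "x \<in> U (take (length t) (t @ s)) ((t @ s) ! length t)" using r by simp
        moreover have "length t < length (t @ s)" using s by simp
        ultimately show ?thesis unfolding E_def by blast
      qed
    qed
    then show ?case by blast
  qed
  have V_cov: "\<exists>k. x \<in> V n k" if x: "x \<in> topspace X" for x n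
  proof -
    obtain K where K: "\<And>m k' s. K m \<le> k' \<Longrightarrow> length s = m \<Longrightarrow> x \<in> E s k'"
      using uniform[OF x, of _ "[]"] by (metis append_Nil)
    have "x \<in> V n (Max (K ` {..n}))"
      unfolding V_def
    proof
      fix s assume "s \<in> L n (Max (K ` {..n}))"
      then have "K (length s) \<le> Max (K ` {..n})" by (intro Max_ge) (auto simp: L_def)
      then show "x \<in> E s (Max (K ` {..n}))" using K by blast
    qed
    then show ?thesis ..
  qed
  \<comment> \<open>\<open>V n k\<close> need not increase with \<open>k\<close>, since
    \<open>L n k\<close> grows; the union restores monotonicity.\<close>
  define W where "W n k = (\<Union>j\<le>k. V n j)" for n k
  have W_op: "openin X (W n k)" for n k
    unfolding W_def using \<open>\<And>n k. openin X (V n k)\<close> by auto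
  have W_mono: "mono (W n)" for n
    unfolding W_def by (intro monoI UN_mono) auto
  have W_cov: "(\<Union>k. W n k) = topspace X" for n
  proof
    show "(\<Union>k. W n k) \<subseteq> topspace X" using W_op openin_subset by blast
    show "topspace X \<subseteq> (\<Union>k. W n k)" using V_cov[of _ n] unfolding W_def by blast
  qed
  obtain g where g: "\<And>x. x \<in> topspace X \<Longrightarrow> \<exists>n. x \<in> W n (g n)"
    by (rule Menger_space_increasing[of X W]) (use assms(1) W_op W_mono W_cov in auto)
  have earlier: "\<exists>n. x \<in> U (map g [0..<n]) (g n)"
    if "x \<in> E (map g [0..<m]) j" "j \<le> g m" for x m j
  proof -
    have "x \<in> U (map g [0..<m]) j \<or> (\<exists>i<m. x \<in> U (map g [0..<i]) (g i))"
      using that(1) unfolding E_def by (auto simp: take_map)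
    then show ?thesis using monoD[OF mono that(2)] by blast
  qed
  have "\<exists>n. x \<in> U (map g [0..<n]) (g n)" if x: "x \<in> topspace X" for x
  proof -
    obtain n j where j: "j \<le> g n" "x \<in> V n j" using g[OF x] by (auto simp: W_def)
    \<comment> \<open>Before the first index \<open>m\<close> whose answer reaches \<open>j\<close>,
      all answers are below \<open>j\<close>, so the position of length \<open>m\<close> is among
      the finitely many in \<open>L n j\<close>.\<close>
    define m where "m = (LEAST i. j \<le> g i)"
    have m: "j \<le> g m" "m \<le> n" and less: "\<And>i. i < m \<Longrightarrow> g i < j"
      unfolding m_def using j(1) by (auto intro: LeastI Least_le dest: not_less_Least)
    have "map g [0..<m] \<in> L n j" using m less by (auto simp: L_def)
    then show ?thesis using earlier m(1) j(2) by (auto simp: V_def)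
  qed
  then show thesis by (rule that)
qed

text \<open>The game with states in place of histories: folding \<open>step\<close> over the answers
  so far gives the current state.\<close>

lemma Menger_space_game:
  fixes U :: "'s \<Rightarrow> nat \<Rightarrow> 'a set" and step :: "'s \<Rightarrow> nat \<Rightarrow> 's"
  assumes "Menger_space X"
    and "\<And>q k. openin X (U q k)" "\<And>q. mono (U q)" "\<And>q. (\<Union>k. U q k) = topspace X"
  obtains q g where "q 0 = q0" "\<And>n. q (Suc n) = step (q n) (g n)"
    "\<And>x. x \<in> topspace X \<Longrightarrow> \<exists>n. x \<in> U (q n) (g n)"
proof -
  obtain g where g: "\<And>x. x \<in> topspace X \<Longrightarrow> \<exists>n. x \<in> U (foldl step q0 (map g [0..<n])) (g n)"
    by (rule Menger_space_game_lists[OF assms(1), of "\<lambda>s. U (foldl step q0 s)"]) (use assms in auto)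
  show thesis
    by (rule that[of "\<lambda>n. foldl step q0 (map g [0..<n])" g]) (use g in auto)
qed

section \<open>Closed subsets of the Baire space mapped into Menger spaces\<close>

text \<open>Closedness is required separately because \<open>X\<close> need not be Hausdorff; it
  lets a covering set absorb points indistinguishable from its own.\<close>

definition sigma_compactly_covered :: "'a topology \<Rightarrow> 'a set \<Rightarrow> bool" where
  "sigma_compactly_covered X D \<longleftrightarrow>
     (\<exists>\<K>. countable \<K> \<and> (\<forall>K\<in>\<K>. compactin X K \<and> closedin X K) \<and> D \<subseteq> \<Union>\<K>)"

lemma sigma_compactly_covered_UN:
  assumes "countable I" "\<And>i. i \<in> I \<Longrightarrow> sigma_compactly_covered X (D i)"
  shows "sigma_compactly_covered X (\<Union>i\<in>I. D i)"
proof -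
  have "\<forall>i\<in>I. \<exists>\<K>. countable \<K> \<and> (\<forall>K\<in>\<K>. compactin X K \<and> closedin X K) \<and> D i \<subseteq> \<Union>\<K>"
    using assms(2) by (simp add: sigma_compactly_covered_def)
  then obtain \<K> where \<K>: "\<forall>i\<in>I. countable (\<K> i) \<and> (\<forall>K\<in>\<K> i. compactin X K \<and> closedin X K) \<and> D i \<subseteq> \<Union>(\<K> i)"
    by (rule bchoice[THEN exE])
  show ?thesis
    unfolding sigma_compactly_covered_def
  proof (intro exI[of _ "\<Union>i\<in>I. \<K> i"] conjI)
    show "countable (\<Union>i\<in>I. \<K> i)" using assms(1) \<K> by auto
    show "\<forall>K\<in>\<Union>i\<in>I. \<K> i. compactin X K \<and> closedin X K"
    proof
      fix K assume "K \<in> (\<Union>i\<in>I. \<K> i)"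
      then obtain i where "i \<in> I" "K \<in> \<K> i" by blast
      then show "compactin X K \<and> closedin X K" using \<K>[rule_format, of i] by simp
    qed
    show "(\<Union>i\<in>I. D i) \<subseteq> \<Union>(\<Union>i\<in>I. \<K> i)"
    proof
      fix x assume "x \<in> (\<Union>i\<in>I. D i)"
      then obtain i where i: "i \<in> I" "x \<in> D i" by blast
      then have "D i \<subseteq> \<Union>(\<K> i)" using \<K> by simp
      then show "x \<in> \<Union>(\<Union>i\<in>I. \<K> i)" using i by blast
    qed
  qed
qed

lemma sigma_compactly_covered_subset:
  assumes "sigma_compactly_covered X D" "C \<subseteq> D"
  shows "sigma_compactly_covered X C"
proof -
  obtain \<K> where "countable \<K>" "\<forall>K\<in>\<K>. compactin X K \<and> closedin X K" "D \<subseteq> \<Union>\<K>"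
    using assms(1) unfolding sigma_compactly_covered_def by (elim exE conjE)
  then show ?thesis
    unfolding sigma_compactly_covered_def using assms(2) by (intro exI[of _ \<K>]) simp
qed

lemma sigma_compactly_covered_imp_sigma_compact_space:
  assumes "sigma_compactly_covered X (topspace X)"
  shows "sigma_compact_space X"
proof -
  obtain \<K> where \<K>: "countable \<K>" "\<And>K. K \<in> \<K> \<Longrightarrow> compactin X K" "topspace X \<subseteq> \<Union>\<K>"
    using assms unfolding sigma_compactly_covered_def by blast
  \<comment> \<open>Adding the empty set keeps the enumerated family nonempty.\<close>
  have ran: "range (from_nat_into (insert {} \<K>)) = insert {} \<K>"
    using \<K>(1) by (intro range_from_nat_into) auto
  have "compactin X (from_nat_into (insert {} \<K>) n)" for n
    using from_nat_into[of "insert {} \<K>" n] \<K>(2) by auto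
  moreover have "(\<Union>n. from_nat_into (insert {} \<K>) n) = topspace X"
  proof -
    have "\<Union>\<K> \<subseteq> topspace X" by (intro Union_least compactin_subset_topspace \<K>(2))
    then show ?thesis unfolding ran using \<K>(3) by simp
  qed
  ultimately show ?thesis
    unfolding sigma_compact_space_def by (intro exI[of _ "from_nat_into (insert {} \<K>)"]) simp
qed

lemma regular_space_shrink:
  assumes "regular_space X" "openin X U" "x \<in> U"
  obtains V where "openin X V" "x \<in> V" "X closure_of V \<subseteq> U"
proof -
  have "x \<in> topspace X" using assms openin_subset by blast
  then obtain V where "openin X V" "x \<in> V" "disjnt (topspace X - U) (X closure_of V)"
    using assms unfolding regular_space by (metis Diff_iff closedin_diff closedin_topspace)
  then show thesis
    using that closure_of_subset_topspace[of X V] by (auto simp: disjnt_iff)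
qed

text \<open>Add the complement of the closure of \<open>D\<close> to a cover of that closure without
  finite subcover, and shrink by regularity so that closures of the new sets stay inside the old
  ones. Countably many new sets suffice, and \<open>U k\<close> are their finite unions: if the
  closure of some \<open>U k\<close> contained \<open>D\<close>, the first cover would have a finite
  subcover.\<close>

lemma noncompact_closure_cover:
  assumes "regular_space X" "Menger_space X" "\<not> compactin X (X closure_of D)"
  obtains U :: "nat \<Rightarrow> 'a set" where
    "\<And>k. openin X (U k)" "mono U" "(\<Union>k. U k) = topspace X" "\<And>k. \<not> D \<inter> topspace X \<subseteq> X closure_of U k"
proof -
  have "\<exists>\<G>. (\<forall>G\<in>\<G>. openin X G) \<and> X closure_of D \<subseteq> \<Union>\<G> \<and>
      (\<forall>\<F>. finite \<F> \<longrightarrow> \<F> \<subseteq> \<G> \<longrightarrow> \<not> X closure_of D \<subseteq> \<Union>\<F>)"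
    using assms(3) closure_of_subset_topspace[of X D] unfolding compactin_def
    by (simp only: de_Morgan_conj not_all not_imp not_ex simp_thms) metis
  then obtain \<G> where \<G>: "\<forall>G\<in>\<G>. openin X G" "X closure_of D \<subseteq> \<Union>\<G>"
    and nofin: "\<forall>\<F>. finite \<F> \<longrightarrow> \<F> \<subseteq> \<G> \<longrightarrow> \<not> X closure_of D \<subseteq> \<Union>\<F>"
    by (elim exE conjE)
  let ?\<H> = "insert (topspace X - X closure_of D) \<G>"
  define \<U> where "\<U> = {V. openin X V \<and> (\<exists>H\<in>?\<H>. X closure_of V \<subseteq> H)}"
  have "open_cover X \<U>"
  proof -
    have "x \<in> \<Union>\<U>" if "x \<in> topspace X" for x
    proof -
      have "\<exists>H\<in>?\<H>. openin X H \<and> x \<in> H"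
        using that \<G> by (cases "x \<in> X closure_of D") auto
      then obtain H V where "H \<in> ?\<H>" "openin X V" "x \<in> V" "X closure_of V \<subseteq> H"
        using regular_space_shrink[OF assms(1)] by metis
      then show ?thesis by (auto simp: \<U>_def)
    qed
    then show ?thesis
      unfolding open_cover_def \<U>_def using openin_subset by blast
  qed
  then obtain \<V> where \<V>: "countable \<V>" "\<V> \<subseteq> \<U>" "\<Union>\<V> = topspace X"
    by (rule Menger_space_countable_subcover[OF assms(2)])
  let ?v = "from_nat_into (insert {} \<V>)"
  have ran: "range ?v = insert {} \<V>"
    using \<V>(1) by (intro range_from_nat_into) auto
  have v: "openin X (?v i) \<and> (\<exists>H\<in>?\<H>. X closure_of (?v i) \<subseteq> H)" for i
  proof -
    have "?v i \<in> insert {} \<V>" by (rule from_nat_into) simp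
    then show ?thesis using \<V>(2) by (auto simp: \<U>_def)
  qed
  then have "\<forall>i. \<exists>H. H \<in> ?\<H> \<and> X closure_of (?v i) \<subseteq> H" by blast
  then obtain h where h: "\<forall>i. h i \<in> ?\<H> \<and> X closure_of (?v i) \<subseteq> h i"
    by (rule choice[THEN exE])
  define U where "U k = (\<Union>i<k. ?v i)" for k
  show thesis
  proof (rule that[of U])
    show "openin X (U k)" for k unfolding U_def using v by blast
    show "mono U" unfolding U_def by (intro monoI UN_mono) auto
    have "(\<Union>k. U k) = \<Union>(range ?v)" unfolding U_def by auto
    then show "(\<Union>k. U k) = topspace X" unfolding ran using \<V>(3) by simp
    show "\<not> D \<inter> topspace X \<subseteq> X closure_of U k" for k
    proof
      assume "D \<inter> topspace X \<subseteq> X closure_of U k"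
      then have "X closure_of D \<subseteq> X closure_of U k"
        by (metis closedin_closure_of closure_of_minimal closure_of_restrict inf_commute)
      also have "\<dots> = (\<Union>i<k. X closure_of ?v i)"
        unfolding U_def by (subst closure_of_Union) auto
      also have "\<dots> \<subseteq> (\<Union>i<k. h i)" using h by blast
      \<comment> \<open>An \<open>h i\<close> outside \<open>\<G>\<close> is the complement of the
        closure of \<open>D\<close> and covers none of it.\<close>
      finally have "X closure_of D \<subseteq> \<Union>(h ` {..<k} \<inter> \<G>)" using h by blast
      then show False using nofin[rule_format, of "h ` {..<k} \<inter> \<G>"] by simp
    qed
  qed
qed

lemma Menger_space_closed_image:
  fixes F :: "baire \<Rightarrow> 'a"
  assumes reg: "regular_space X" and men: "Menger_space X"
    and B: "closed B" and F: "continuous_map (top_of_set B) X F"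
  shows "sigma_compactly_covered X (F ` B)"
proof (rule ccontr)
  assume not_covered: "\<not> ?thesis"
  \<comment> \<open>As in the Cantor--Bendixson analysis, discard the cylinders whose image is already covered; on
    the rest every nonempty cylinder has an image with noncompact closure, so that the first
    player can always play a cover that no finite subfamily exhausts.\<close>
  define B' where "B' = {y \<in> B. \<forall>n. \<not> sigma_compactly_covered X (F ` (B \<inter> cyl (map y [0..<n])))}"
  have F_X: "F y \<in> topspace X" if "y \<in> B" for y
    using F that by (auto simp: continuous_map_def)
  let ?I = "{s. sigma_compactly_covered X (F ` (B \<inter> cyl s))}"
  \<comment> \<open>There are only countably many finite sequences, so the whole discarded image is
    still covered.\<close>
  have removed: "sigma_compactly_covered X (\<Union>s\<in>?I. F ` (B \<inter> cyl s))"
    by (rule sigma_compactly_covered_UN) auto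
  have split: "F ` (B \<inter> cyl s) \<subseteq> F ` (B' \<inter> cyl s) \<union> (\<Union>s\<in>?I. F ` (B \<inter> cyl s))" for s
  proof
    fix x assume "x \<in> F ` (B \<inter> cyl s)"
    then obtain y where y: "x = F y" "y \<in> B" "y \<in> cyl s" by auto
    show "x \<in> F ` (B' \<inter> cyl s) \<union> (\<Union>s\<in>?I. F ` (B \<inter> cyl s))"
    proof (cases "y \<in> B'")
      case False
      then obtain n where "sigma_compactly_covered X (F ` (B \<inter> cyl (map y [0..<n])))"
        using y(2) by (auto simp: B'_def)
      then show ?thesis using y in_cyl_map[of y n] by blast
    qed (use y in blast)
  qed
  have not_covered': "\<not> sigma_compactly_covered X (F ` (B' \<inter> cyl s))"
    if "\<not> sigma_compactly_covered X (F ` (B \<inter> cyl s))" for s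
  proof
    assume "sigma_compactly_covered X (F ` (B' \<inter> cyl s))"
    then have "sigma_compactly_covered X (\<Union>D\<in>{F ` (B' \<inter> cyl s), \<Union>s\<in>?I. F ` (B \<inter> cyl s)}. D)"
      using removed by (intro sigma_compactly_covered_UN) auto
    moreover have "F ` (B \<inter> cyl s) \<subseteq> (\<Union>D\<in>{F ` (B' \<inter> cyl s), \<Union>s\<in>?I. F ` (B \<inter> cyl s)}. D)"
      using split[of s] by simp
    ultimately show False using that sigma_compactly_covered_subset by blast
  qed
  define Q where "Q = {s. B' \<inter> cyl s \<noteq> {}}"
  have noncompact: "\<not> compactin X (X closure_of (F ` (B' \<inter> cyl s)))" if "s \<in> Q" for s
  proof
    assume comp: "compactin X (X closure_of (F ` (B' \<inter> cyl s)))"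
    have "F ` (B' \<inter> cyl s) \<subseteq> X closure_of (F ` (B' \<inter> cyl s))"
      using F_X by (intro closure_of_subset) (auto simp: B'_def)
    then have "sigma_compactly_covered X (F ` (B' \<inter> cyl s))"
      unfolding sigma_compactly_covered_def
      using comp by (intro exI[of _ "{X closure_of (F ` (B' \<inter> cyl s))}"]) auto
    moreover obtain y where y: "y \<in> B'" "y \<in> cyl s" using \<open>s \<in> Q\<close> by (auto simp: Q_def)
    have "map y [0..<length s] = s" using y(2) by (simp add: cyl_def)
    then have "\<not> sigma_compactly_covered X (F ` (B \<inter> cyl s))"
      using y(1) unfolding B'_def by (metis (mono_tags, lifting) mem_Collect_eq)
    ultimately show False using not_covered' by blast
  qed
  have "\<exists>U :: nat \<Rightarrow> 'a set. (\<forall>k. openin X (U k)) \<and> mono U \<and> (\<Union>k. U k) = topspace X \<and>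
      (s \<in> Q \<longrightarrow> (\<forall>k. \<exists>r. r \<noteq> [] \<and> s @ r \<in> Q \<and> F ` (B \<inter> cyl (s @ r)) \<inter> U k = {}))" for s
  proof (cases "s \<in> Q")
    case True
    obtain U :: "nat \<Rightarrow> 'a set" where U: "\<And>k. openin X (U k)" "mono U" "(\<Union>k. U k) = topspace X"
        "\<And>k. \<not> F ` (B' \<inter> cyl s) \<inter> topspace X \<subseteq> X closure_of U k"
      by (rule noncompact_closure_cover[OF reg men noncompact[OF True]]) (rule that)
    have "\<exists>r. r \<noteq> [] \<and> s @ r \<in> Q \<and> F ` (B \<inter> cyl (s @ r)) \<inter> U k = {}" for k
    proof -
      obtain y where y: "y \<in> B'" "y \<in> cyl s" "F y \<notin> X closure_of U k" using U(4)[of k] by blast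
      have "openin (top_of_set B) {b \<in> topspace (top_of_set B). F b \<in> topspace X - X closure_of U k}"
        by (rule openin_continuous_map_preimage[OF F]) auto
      then obtain O' where O': "open O'" "{b \<in> B. F b \<in> topspace X - X closure_of U k} = B \<inter> O'"
        by (auto simp: openin_open)
      have yB: "y \<in> B" using y(1) by (simp add: B'_def)
      then have "y \<in> O'" using O'(2) y F_X by blast
      then obtain n where n: "cyl (map y [0..<n]) \<subseteq> O'" using open_contains_cyl O'(1) by blast
      \<comment> \<open>Exceeding both bounds, \<open>m\<close> makes the cylinder lie inside
        \<open>O'\<close> and the extension \<open>r\<close> nonempty.\<close>
      define m where "m = Suc (max n (length s))"
      define r where "r = map y [length s..<m]"
      have "map y [0..<m] = map y [0..<length s] @ r"
        unfolding r_def map_append[symmetric]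
        using upt_add_eq_append[of 0 "length s" "m - length s"] by (simp add: m_def)
      then have sr: "s @ r = map y [0..<m]" using y(2) by (simp add: cyl_def)
      have "r \<noteq> []" by (auto simp: r_def m_def)
      moreover have "s @ r \<in> Q" unfolding sr Q_def using y(1) in_cyl_map by blast
      moreover have "F ` (B \<inter> cyl (s @ r)) \<inter> U k = {}"
      proof -
        have "cyl (s @ r) \<subseteq> cyl (map y [0..<n])"
          unfolding sr by (auto simp: in_cyl_iff m_def simp del: upt_Suc)
        then have "F b \<notin> X closure_of U k" if "b \<in> B" "b \<in> cyl (s @ r)" for b
          using that n O'(2) by blast
        moreover have "U k \<subseteq> X closure_of U k"
          by (intro closure_of_subset openin_subset U)
        ultimately show ?thesis by blast
      qed
      ultimately show ?thesis by blast
    qed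
    then show ?thesis using U(1-3) by blast
  next
    case False
    \<comment> \<open>Positions outside \<open>Q\<close> never arise in the play below; a constant
      cover serves as default.\<close>
    then show ?thesis by (intro exI[of _ "\<lambda>_. topspace X"]) (auto intro: monoI)
  qed
  then have "\<forall>s. \<exists>U :: nat \<Rightarrow> 'a set. (\<forall>k. openin X (U k)) \<and> mono U \<and> (\<Union>k. U k) = topspace X \<and>
      (s \<in> Q \<longrightarrow> (\<forall>k. \<exists>r. r \<noteq> [] \<and> s @ r \<in> Q \<and> F ` (B \<inter> cyl (s @ r)) \<inter> U k = {}))" by (rule allI)
  then obtain U :: "nat list \<Rightarrow> nat \<Rightarrow> 'a set" where
    U: "\<forall>s. (\<forall>k. openin X (U s k)) \<and> mono (U s) \<and> (\<Union>k. U s k) = topspace X \<and>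
      (s \<in> Q \<longrightarrow> (\<forall>k. \<exists>r. r \<noteq> [] \<and> s @ r \<in> Q \<and> F ` (B \<inter> cyl (s @ r)) \<inter> U s k = {}))"
    by (rule choice[THEN exE])
  define r where "r s k = (SOME r. r \<noteq> [] \<and> s @ r \<in> Q \<and> F ` (B \<inter> cyl (s @ r)) \<inter> U s k = {})" for s k
  have r: "r s k \<noteq> [] \<and> s @ r s k \<in> Q \<and> F ` (B \<inter> cyl (s @ r s k)) \<inter> U s k = {}" if "s \<in> Q" for s k
    unfolding r_def
  proof (rule someI_ex)
    show "\<exists>r. r \<noteq> [] \<and> s @ r \<in> Q \<and> F ` (B \<inter> cyl (s @ r)) \<inter> U s k = {}"
      using U[THEN spec, of s, THEN conjunct2, THEN conjunct2, THEN conjunct2, THEN mp, OF that] by (rule spec)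
  qed
  have U': "openin X (U s k)" "mono (U s)" "(\<Union>k. U s k) = topspace X" for s k
    using U[THEN spec, of s] by (elim conjE, simp only:)+
  obtain q g where q: "q 0 = []" "\<And>n. q (Suc n) = q n @ r (q n) (g n)"
    and g: "\<And>x. x \<in> topspace X \<Longrightarrow> \<exists>n. x \<in> U (q n) (g n)"
    by (rule Menger_space_game[OF men, of U "[]" "\<lambda>s k. s @ r s k"]) (rule U' that, assumption?)+
  have cyl_Nil: "cyl [] = UNIV" by (simp add: cyl_def)
  have "F ` (B' \<inter> cyl []) \<noteq> {}"
  proof
    assume "F ` (B' \<inter> cyl []) = {}"
    then have "sigma_compactly_covered X (F ` (B' \<inter> cyl []))"
      unfolding sigma_compactly_covered_def by (intro exI[of _ "{}"]) auto
    then show False using not_covered'[of "[]"] not_covered by (simp add: cyl_Nil)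
  qed
  then have "q n \<in> Q" for n
    by (induction n) (use q r in \<open>auto simp: Q_def\<close>)
  then have step: "r (q n) (g n) \<noteq> []" "F ` (B \<inter> cyl (q (Suc n))) \<inter> U (q n) (g n) = {}" for n
    using r q(2) by auto
  obtain y where y: "\<And>n. y \<in> cyl (q n)" and len: "\<And>n. n \<le> length (q n)"
    by (rule chain_in_cyl[of q]) (use q(2) step(1) in auto)
  \<comment> \<open>Every \<open>q n\<close> is an initial segment of a point of \<open>B\<close>,
    so closedness puts the limit \<open>y\<close> into \<open>B\<close>.\<close>
  have "y \<in> B"
  proof (rule ccontr)
    assume "y \<notin> B"
    then obtain n where n: "cyl (map y [0..<n]) \<subseteq> - B"
      using open_contains_cyl[of "- B" y] B by auto
    obtain b where b: "b \<in> B'" "b \<in> cyl (q n)" using \<open>q n \<in> Q\<close> by (auto simp: Q_def)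
    have "b \<in> cyl (map y [0..<n])"
      using b(2) y[of n] len[of n] by (auto simp: in_cyl_iff)
    then show False using n b(1) by (auto simp: B'_def)
  qed
  obtain n where "F y \<in> U (q n) (g n)" using g[OF F_X[OF \<open>y \<in> B\<close>]] by (rule exE)
  then show False using step(2)[of n] y[of "Suc n"] \<open>y \<in> B\<close> by blast
qed

section \<open>Runs against a strategy\<close>

lemma exists_run: "\<exists>x :: baire. \<forall>n. x n = g (map x [0..<n])"
proof -
  define h where "h = rec_nat [] (\<lambda>_ l. l @ [g l])"
  have h: "h 0 = []" "\<And>n. h (Suc n) = h n @ [g (h n)]" by (simp_all add: h_def)
  have "map (\<lambda>n. g (h n)) [0..<n] = h n" for n
    by (induction n) (simp_all add: h)
  then show ?thesis by (intro exI[of _ "\<lambda>n. g (h n)"]) simp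
qed

text \<open>In the run \<open>\<rho> v\<close>, I follows \<open>s\<close> while II plays
  \<open>v\<close>. Move \<open>i\<close> of I sees only the entries of \<open>v\<close> below
  \<open>i\<close>, whence the Lipschitz clause.\<close>

lemma run_against_I:
  obtains \<rho> :: "baire \<Rightarrow> baire" where
    "\<And>v. follows_I s (\<rho> v)" "\<And>v. odds (\<rho> v) = v"
    "\<And>v v' k i. \<forall>j<k. v j = v' j \<Longrightarrow> i < k \<Longrightarrow> evens (\<rho> v) i = evens (\<rho> v') i"
proof -
  define m where "m v l = (if even (length l) then s l else v (length l div 2))" for v :: baire and l
  have "\<forall>v. \<exists>x :: baire. \<forall>n. x n = m v (map x [0..<n])"
    by (rule allI, rule exists_run)
  then obtain \<rho> where \<rho>: "\<forall>v n. \<rho> v n = m v (map (\<rho> v) [0..<n])"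
    by (rule choice[THEN exE])
  show thesis
  proof (rule that[of \<rho>])
    show "follows_I s (\<rho> v)" for v
      unfolding follows_I_def using \<rho>[THEN spec, THEN spec, of v "2 * _"] by (simp add: m_def)
    show "odds (\<rho> v) = v" for v
    proof
      fix i show "odds (\<rho> v) i = v i"
        using \<rho>[THEN spec, THEN spec, of v "2 * i + 1"] by (simp add: odds_def m_def)
    qed
    fix v v' :: baire and k i
    assume eq: "\<forall>j<k. v j = v' j" and "i < k"
    have "\<rho> v n = \<rho> v' n" if "n < 2 * k" for n
      using that
    proof (induction n rule: less_induct)
      case (less n)
      have hist: "map (\<rho> v) [0..<n] = map (\<rho> v') [0..<n]" using less by simp
      have "m v (map (\<rho> v') [0..<n]) = m v' (map (\<rho> v') [0..<n])"
        using less.prems by (auto simp: m_def intro!: eq[rule_format])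
      then show ?case
        using \<rho>[THEN spec, THEN spec, of v n] \<rho>[THEN spec, THEN spec, of v' n] hist by simp
    qed
    then show "evens (\<rho> v) i = evens (\<rho> v') i" using \<open>i < k\<close> by (simp add: evens_def)
  qed
qed

text \<open>II moves after I, so answer \<open>i\<close> depends on the entries of \<open>u\<close>
  up to and including \<open>i\<close>; these still lie below \<open>k\<close>.\<close>

lemma run_against_II:
  obtains \<rho> :: "baire \<Rightarrow> baire" where
    "\<And>u. follows_II s (\<rho> u)" "\<And>u. evens (\<rho> u) = u"
    "\<And>u u' k i. \<forall>j<k. u j = u' j \<Longrightarrow> i < k \<Longrightarrow> odds (\<rho> u) i = odds (\<rho> u') i"
proof -
  define m where "m u l = (if odd (length l) then s l else u (length l div 2))" for u :: baire and l
  have "\<forall>u. \<exists>x :: baire. \<forall>n. x n = m u (map x [0..<n])"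
    by (rule allI, rule exists_run)
  then obtain \<rho> where \<rho>: "\<forall>u n. \<rho> u n = m u (map (\<rho> u) [0..<n])"
    by (rule choice[THEN exE])
  show thesis
  proof (rule that[of \<rho>])
    show "follows_II s (\<rho> u)" for u
      unfolding follows_II_def using \<rho>[THEN spec, THEN spec, of u "2 * _ + 1"] by (simp add: m_def)
    show "evens (\<rho> u) = u" for u
    proof
      fix i show "evens (\<rho> u) i = u i"
        using \<rho>[THEN spec, THEN spec, of u "2 * i"] by (simp add: evens_def m_def)
    qed
    fix u u' :: baire and k i
    assume eq: "\<forall>j<k. u j = u' j" and "i < k"
    have "\<rho> u n = \<rho> u' n" if "n < 2 * k" for n
      using that
    proof (induction n rule: less_induct)
      case (less n)
      have hist: "map (\<rho> u) [0..<n] = map (\<rho> u') [0..<n]" using less by simp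
      have "m u (map (\<rho> u') [0..<n]) = m u' (map (\<rho> u') [0..<n])"
        using less.prems by (auto simp: m_def intro!: eq[rule_format])
      then show ?case
        using \<rho>[THEN spec, THEN spec, of u n] \<rho>[THEN spec, THEN spec, of u' n] hist by simp
    qed
    then show "odds (\<rho> u) i = odds (\<rho> u') i" using \<open>i < k\<close> by (simp add: odds_def)
  qed
qed

section \<open>Coding a space by reals\<close>

text \<open>For open \<open>W p\<close> and closed \<open>C p\<close> both alternatives are closed
  conditions on \<open>x\<close>, so a wrong entry is refuted on an open set. Points of
  \<open>C p\<close> outside \<open>W p\<close> allow both.\<close>

definition codes :: "'a topology \<Rightarrow> (nat \<Rightarrow> 'a set) \<Rightarrow> (nat \<Rightarrow> 'a set) \<Rightarrow> baire \<Rightarrow> 'a \<Rightarrow> bool" where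
  "codes X W C z x \<longleftrightarrow> x \<in> topspace X \<and> (\<forall>p. if z p = 0 then x \<notin> W p else x \<in> C p)"

lemma exists_code:
  assumes "\<And>p. W p \<subseteq> C p" "x \<in> topspace X"
  shows "\<exists>z. codes X W C z x"
  using assms by (intro exI[of _ "\<lambda>p. if x \<in> C p then 1 else 0"]) (auto simp: codes_def)

lemma Menger_space_no_reduction:
  fixes \<phi> :: "baire \<Rightarrow> baire"
  assumes men: "Menger_space X"
    and W: "\<And>p. openin X (W p)" and C: "\<And>p. closedin X (C p)"
    and lip: "\<And>v v' k i. \<forall>j<k. v j = v' j \<Longrightarrow> i < k \<Longrightarrow> \<phi> v i = \<phi> v' i"
    and red: "\<And>v. (\<exists>x. codes X W C (\<phi> v) x) \<longleftrightarrow> infinite {i. v i \<noteq> 0}"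
  shows False
proof -
  \<comment> \<open>At position \<open>s\<close> the first player uses that \<open>\<phi>\<close> maps \<open>s\<close> followed by zeros to a noncode \<open>d s\<close>; the
    answer \<open>k\<close> is met by appending \<open>k\<close> zeros and a one, which leaves the first \<open>k\<close> entries of \<open>\<phi>\<close>
    unchanged.\<close>
  define pad where "pad s = (\<lambda>i. if i < length s then s ! i else 0)" for s :: "nat list"
  define d where "d s = \<phi> (pad s)" for s
  \<comment> \<open>The open set of points at which entry \<open>p\<close> of \<open>d s\<close> is
    wrong; as \<open>d s\<close> is no code, these sets cover \<open>X\<close>.\<close>
  define G where "G s p = (if d s p = 0 then W p else topspace X - C p)" for s p
  define U where "U s k = (\<Union>p<k. G s p)" for s k
  have G: "openin X (G s p)" for s p using W C by (auto simp: G_def)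
  have U_open: "openin X (U s k)" for s k unfolding U_def using G by blast
  have U_mono: "mono (U s)" for s unfolding U_def by (intro monoI UN_mono) auto
  have U_cov: "(\<Union>k. U s k) = topspace X" for s
  proof
    show "(\<Union>k. U s k) \<subseteq> topspace X" by (intro UN_least openin_subset U_open)
    have "finite {i. pad s i \<noteq> 0}"
      by (rule finite_subset[of _ "{..<length s}"]) (auto simp: pad_def split: if_splits)
    then have nc: "\<not> codes X W C (d s) x" for x using red[of "pad s"] by (auto simp: d_def)
    show "topspace X \<subseteq> (\<Union>k. U s k)"
    proof
      fix x assume x: "x \<in> topspace X"
      then obtain p where "\<not> (if d s p = 0 then x \<notin> W p else x \<in> C p)"
        using nc[of x] unfolding codes_def by blast
      then have "x \<in> G s p" using x by (auto simp: G_def split: if_splits)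
      then have "x \<in> U s (Suc p)" by (auto simp: U_def)
      then show "x \<in> (\<Union>k. U s k)" by blast
    qed
  qed
  obtain q g where q: "q 0 = []" "\<And>n. q (Suc n) = q n @ replicate (g n) 0 @ [1]"
    and g: "\<And>x. x \<in> topspace X \<Longrightarrow> \<exists>n. x \<in> U (q n) (g n)"
    by (rule Menger_space_game[OF men, of U "[]" "\<lambda>s k. s @ replicate k 0 @ [1]"])
      (rule U_open U_mono U_cov that, assumption?)+
  obtain v where v: "\<And>n. v \<in> cyl (q n)" and len: "\<And>n. n \<le> length (q n)"
    by (rule chain_in_cyl[of q]) (use q(2) in auto)
  \<comment> \<open>Each round appends a one at a later place, so \<open>\<phi> v\<close> is a
    code.\<close>
  have "infinite {i. v i \<noteq> 0}"
    unfolding infinite_nat_iff_unbounded_le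
  proof
    fix n
    let ?i = "length (q n) + g n"
    have "v ?i = 1"
      using v[of "Suc n"] unfolding in_cyl_iff q(2) by (auto simp: nth_append dest!: spec[of _ ?i])
    then show "\<exists>i\<ge>n. i \<in> {i. v i \<noteq> 0}" using len[of n] by (intro exI[of _ ?i]) auto
  qed
  then obtain x where x: "codes X W C (\<phi> v) x" using red by blast
  then have "x \<in> topspace X" by (simp add: codes_def)
  from g[OF this] obtain n where "x \<in> U (q n) (g n)" by (rule exE)
  then obtain p where p: "p < g n" "x \<in> G (q n) p" by (auto simp: U_def)
  \<comment> \<open>Up to the appended one, \<open>v\<close> looks like \<open>q n\<close> padded
    with zeros. Hence entry \<open>p < g n\<close> of \<open>\<phi> v\<close> equals the entry of
    \<open>d (q n)\<close> that is wrong at \<open>x\<close>.\<close>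
  have "v j = pad (q n) j" if "j < length (q n) + g n" for j
  proof -
    have "v j = (q n @ replicate (g n) 0 @ [1]) ! j"
      using v[of "Suc n"] that unfolding in_cyl_iff q(2) by simp
    then show ?thesis using that by (auto simp: pad_def nth_append)
  qed
  then have "\<phi> v p = d (q n) p"
    unfolding d_def using p(1) by (intro lip[of "length (q n) + g n"]) auto
  then show False using x p(2) by (auto simp: codes_def G_def split: if_splits dest: spec[of _ p])
qed

text \<open>Row \<open>s\<close> comes from a network element \<open>N s\<close> around
  \<open>x\<close> inside an open set whose closure lies in \<open>U\<close>. Any point outside
  \<open>U\<close> lies in some \<open>N t\<close> with an open superset whose closure misses
  \<open>N s\<close>. As \<open>V s t\<close> is chosen from \<open>s\<close> and \<open>t\<close>
  alone, countably many sets suffice.\<close>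

lemma regular_space_separating_family:
  fixes N :: "nat \<Rightarrow> 'a set"
  assumes reg: "regular_space X"
    and N: "\<And>U x. openin X U \<Longrightarrow> x \<in> U \<Longrightarrow> \<exists>i. x \<in> N i \<and> N i \<subseteq> U"
  obtains W C :: "nat \<Rightarrow> 'a set" where
    "\<And>p. openin X (W p)" "\<And>p. closedin X (C p)" "\<And>p. W p \<subseteq> C p"
    "\<And>U x. openin X U \<Longrightarrow> x \<in> U \<Longrightarrow>
       \<exists>s. (\<forall>t. x \<notin> C (prod_encode (s, t))) \<and> topspace X - U \<subseteq> (\<Union>t. W (prod_encode (s, t)))"
proof -
  define sep where "sep s t V \<longleftrightarrow> openin X V \<and> N t \<subseteq> V \<and> N s \<inter> X closure_of V = {}" for s t V
  \<comment> \<open>Without a separating set the default is empty, which preserves openness and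
    disjointness from \<open>N s\<close>.\<close>
  define V where "V s t = (if \<exists>V. sep s t V then SOME V. sep s t V else {})" for s t
  have V: "sep s t (V s t)" if "sep s t V'" for s t V'
    unfolding V_def using that someI_ex[of "sep s t"] by auto
  have V_open: "openin X (V s t)" and V_disj: "N s \<inter> X closure_of (V s t) = {}" for s t
    using V[of s t] by (cases "\<exists>V. sep s t V"; auto simp: sep_def V_def)+
  define W where "W p = (case prod_decode p of (s, t) \<Rightarrow> V s t)" for p
  define C where "C p = X closure_of (W p)" for p
  have W_enc: "W (prod_encode (s, t)) = V s t" for s t by (simp add: W_def)
  have W_open: "openin X (W p)" for p using V_open by (auto simp: W_def split: prod.splits)
  show thesis
  proof (rule that[of W C])
    show "openin X (W p)" for p by (rule W_open)
    show "closedin X (C p)" for p by (simp add: C_def)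
    show "W p \<subseteq> C p" for p unfolding C_def by (intro closure_of_subset openin_subset W_open)
    fix U x assume U: "openin X U" "x \<in> U"
    obtain O' where O': "openin X O'" "x \<in> O'" "X closure_of O' \<subseteq> U"
      by (rule regular_space_shrink[OF reg U])
    obtain s where s: "x \<in> N s" "N s \<subseteq> O'" using N[OF O'(1,2)] by blast
    have "topspace X - U \<subseteq> (\<Union>t. V s t)"
    proof
      fix y assume y: "y \<in> topspace X - U"
      have "openin X (topspace X - X closure_of O')" by auto
      moreover have "y \<in> topspace X - X closure_of O'" using y O'(3) by blast
      ultimately obtain P where P: "openin X P" "y \<in> P" "X closure_of P \<subseteq> topspace X - X closure_of O'"
        by (rule regular_space_shrink[OF reg])
      obtain t where t: "y \<in> N t" "N t \<subseteq> P" using N[OF P(1,2)] by blast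
      have "O' \<subseteq> X closure_of O'" by (intro closure_of_subset openin_subset O'(1))
      then have "sep s t P" unfolding sep_def using P t s by blast
      from V[OF this] have "N t \<subseteq> V s t" by (simp add: sep_def)
      then show "y \<in> (\<Union>t. V s t)" using t(1) by blast
    qed
    moreover have "\<forall>t. x \<notin> C (prod_encode (s, t))"
      unfolding C_def W_enc using V_disj s(1) by blast
    ultimately show "\<exists>s. (\<forall>t. x \<notin> C (prod_encode (s, t))) \<and> topspace X - U \<subseteq> (\<Union>t. W (prod_encode (s, t)))"
      unfolding W_enc by blast
  qed
qed

text \<open>The pairs of a point \<open>a\<close> of \<open>A\<close> and a code of
  \<open>f a\<close> are cut out of the \<open>evens\<close>-preimage of \<open>A\<close> by
  countably many closed conditions, and the codes are their projection. The closed sets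
  \<open>Q p\<close> and \<open>R p\<close> stand in for preimages under \<open>f\<close>, which are
  closed only relative to \<open>A\<close>.\<close>

lemma coded_set_in_projective_class:
  assumes A: "A \<in> projective_class"
    and f: "continuous_map (top_of_set A) X f" "f ` A = topspace X"
    and W: "\<And>p :: nat. openin X (W p)" and C: "\<And>p. closedin X (C p)"
  shows "{z. \<exists>x. codes X W C z x} \<in> projective_class"
proof -
  have "\<exists>Q. closed Q \<and> {a \<in> A. f a \<in> D} = A \<inter> Q" if "closedin X D" for D
  proof -
    have "closedin (top_of_set A) {a \<in> topspace (top_of_set A). f a \<in> D}"
      by (rule closedin_continuous_map_preimage[OF f(1) that])
    then show ?thesis by (auto simp: closedin_closed)
  qed
  then have "\<forall>p. \<exists>Q. closed Q \<and> {a \<in> A. f a \<in> C p} = A \<inter> Q"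
    "\<forall>p. \<exists>Q. closed Q \<and> {a \<in> A. f a \<in> topspace X - W p} = A \<inter> Q"
    using W C by blast+
  then obtain Q R where Q: "\<forall>p. closed (Q p) \<and> {a \<in> A. f a \<in> C p} = A \<inter> Q p"
    and R: "\<forall>p. closed (R p) \<and> {a \<in> A. f a \<in> topspace X - W p} = A \<inter> R p"
    by (elim choice[THEN exE])
  define P where "P p = ({w. w (2 * p + 1) = 0} \<inter> evens -` R p) \<union> ({w. w (2 * p + 1) \<noteq> 0} \<inter> evens -` Q p)"
    for p
  define T where "T = evens -` A \<inter> (\<Inter>p. P p)"
  have "P p \<in> projective_class" for p
    unfolding P_def using Q R
    by (intro projective.Un projective.Int projective_class_vimage continuous_on_evens
        closed_in_projective_class closed_coordinate) auto
  then have "(\<Inter>p. P p) \<in> projective_class"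
    by (intro projective.countable_INT) auto
  then have "T \<in> projective_class"
    unfolding T_def using A by (intro projective.Int projective_class_vimage continuous_on_evens)
  then have "odds ` T \<in> projective_class"
    by (intro projective_class_image continuous_on_odds)
  moreover have T_iff: "w \<in> T \<longleftrightarrow> evens w \<in> A \<and> codes X W C (odds w) (f (evens w))" for w
  proof (cases "evens w \<in> A")
    case True
    then have "f (evens w) \<in> topspace X" using f(2) by blast
    moreover have "evens w \<in> Q p \<longleftrightarrow> f (evens w) \<in> C p" for p
      using True Q[THEN spec, of p] by blast
    moreover have "evens w \<in> R p \<longleftrightarrow> f (evens w) \<in> topspace X - W p" for p
      using True R[THEN spec, of p] by blast
    ultimately have "w \<in> P p \<longleftrightarrow> (if odds w p = 0 then f (evens w) \<notin> W p else f (evens w) \<in> C p)" for p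
      by (simp add: P_def odds_def)
    then show ?thesis using True \<open>f (evens w) \<in> topspace X\<close> by (simp add: T_def codes_def)
  qed (simp add: T_def)
  have "odds ` T = {z. \<exists>x. codes X W C z x}"
  proof
    show "odds ` T \<subseteq> {z. \<exists>x. codes X W C z x}" using T_iff by blast
    show "{z. \<exists>x. codes X W C z x} \<subseteq> odds ` T"
    proof
      fix z assume "z \<in> {z. \<exists>x. codes X W C z x}"
      then obtain x where x: "codes X W C z x" by blast
      then obtain a where "a \<in> A" "x = f a" using f(2) by (auto simp: codes_def)
      then have "interleave a z \<in> T" using x by (simp add: T_iff)
      then show "z \<in> odds ` T" by (metis imageI odds_interleave)
    qed
  qed
  ultimately show ?thesis by simp
qed

lemma Menger_space_coded_by_closed_sets:
  fixes K :: "nat \<Rightarrow> baire set"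
  assumes reg: "regular_space X" and men: "Menger_space X"
    and W_le_C: "\<And>p. W p \<subseteq> C p"
    and sep: "\<And>U x. openin X U \<Longrightarrow> x \<in> U \<Longrightarrow>
       \<exists>s. (\<forall>t. x \<notin> C (prod_encode (s, t))) \<and> topspace X - U \<subseteq> (\<Union>t. W (prod_encode (s, t)))"
    and K: "\<And>n. closed (K n)" "{z. \<exists>x. codes X W C z x} = (\<Union>n. K n)"
  shows "sigma_compact_space X"
proof -
  \<comment> \<open>A zero row acts as a neighbourhood: \<open>x\<close> misses every
    \<open>C\<close> of row \<open>s\<close>, which forces zeros, while a point outside
    \<open>U\<close> lies in some \<open>W\<close> of that row, which forbids a zero.\<close>
  have key: "\<exists>s. (\<forall>t. z (prod_encode (s, t)) = 0) \<and>
      (\<forall>z' x'. codes X W C z' x' \<longrightarrow> (\<forall>t. z' (prod_encode (s, t)) = 0) \<longrightarrow> x' \<in> U)"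
    if z: "codes X W C z x" and U: "openin X U" "x \<in> U" for z x U
  proof -
    obtain s where s: "\<forall>t. x \<notin> C (prod_encode (s, t))" "topspace X - U \<subseteq> (\<Union>t. W (prod_encode (s, t)))"
      using sep[OF U] by blast
    have "z (prod_encode (s, t)) = 0" for t
      using z s(1) unfolding codes_def by metis
    moreover have "x' \<in> U" if z': "codes X W C z' x'" "\<forall>t. z' (prod_encode (s, t)) = 0" for z' x'
    proof (rule ccontr)
      assume "x' \<notin> U"
      then obtain t where "x' \<in> W (prod_encode (s, t))"
        using z'(1) s(2) unfolding codes_def by blast
      then show False using z' unfolding codes_def by metis
    qed
    ultimately show ?thesis by blast
  qed
  \<comment> \<open>The second component \<open>e\<close> of a pair records for each \<open>s\<close> whether the code vanishes on the row \<open>s\<close>,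
    or else where it does not. This makes decoding continuous, as the vanishing of a row becomes
    an open condition.\<close>
  define B where "B n = {w. evens w \<in> K n \<and> (\<forall>s t.
      (odds w s = 0 \<longrightarrow> evens w (prod_encode (s, t)) = 0) \<and>
      (odds w s = Suc t \<longrightarrow> evens w (prod_encode (s, t)) \<noteq> 0))}" for n
  have B_zero: "evens w (prod_encode (s, t)) = 0" if "w \<in> B n" "odds w s = 0" for w n s t
    using that unfolding B_def by blast
  have B_Suc: "evens w (prod_encode (s, t)) \<noteq> 0" if "w \<in> B n" "odds w s = Suc t" for w n s t
    using that unfolding B_def by blast
  have closed_B: "closed (B n)" for n
  proof -
    have "B n = evens -` K n \<inter> (\<Inter>s t.
        ({w. w (2 * s + 1) \<noteq> 0} \<union> {w. w (2 * prod_encode (s, t)) = 0}) \<inter>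
        ({w. w (2 * s + 1) \<noteq> Suc t} \<union> {w. w (2 * prod_encode (s, t)) \<noteq> 0}))"
      unfolding B_def evens_def odds_def by blast
    then show ?thesis
      using K(1) by (auto intro!: closed_Int closed_INT closed_Un closed_coordinate
          closed_vimage continuous_on_evens)
  qed
  \<comment> \<open>Points with a common code are topologically indistinguishable, so any choice
    decodes continuously on \<open>B n\<close>.\<close>
  define F where "F w = (SOME x. codes X W C (evens w) x)" for w
  have F: "codes X W C (evens w) (F w)" if "w \<in> B n" for w n
  proof -
    have "\<exists>x. codes X W C (evens w) x" using that K(2) by (auto simp: B_def)
    then show ?thesis unfolding F_def by (rule someI_ex)
  qed
  have cont: "continuous_map (top_of_set (B n)) X F" for n
    unfolding continuous_map_def
  proof (intro conjI allI impI)
    show "F \<in> topspace (top_of_set (B n)) \<rightarrow> topspace X"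
      using F by (auto simp: codes_def)
    fix U assume U: "openin X U"
    have "\<exists>T. openin (top_of_set (B n)) T \<and> w \<in> T \<and> T \<subseteq> {w \<in> B n. F w \<in> U}"
      if w: "w \<in> B n" "F w \<in> U" for w
    proof -
      obtain s where s: "\<forall>t. evens w (prod_encode (s, t)) = 0"
        and sU: "\<And>z' x'. codes X W C z' x' \<Longrightarrow> \<forall>t. z' (prod_encode (s, t)) = 0 \<Longrightarrow> x' \<in> U"
        using key[OF F[OF w(1)] U w(2)] by blast
      let ?T = "B n \<inter> {w. w (2 * s + 1) = 0}"
      have "odds w s = 0" using B_Suc[OF w(1), of s] s by (cases "odds w s") auto
      then have "w \<in> ?T" using w(1) by (simp add: odds_def)
      moreover have "openin (top_of_set (B n)) ?T"
        by (intro openin_open_Int open_coordinate)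
      moreover have "?T \<subseteq> {w \<in> B n. F w \<in> U}"
      proof
        fix w' assume w': "w' \<in> ?T"
        then have "\<forall>t. evens w' (prod_encode (s, t)) = 0" using B_zero[of w' n s] by (simp add: odds_def)
        then show "w' \<in> {w \<in> B n. F w \<in> U}" using sU F w' by blast
      qed
      ultimately show ?thesis by blast
    qed
    then show "openin (top_of_set (B n)) {w \<in> topspace (top_of_set (B n)). F w \<in> U}"
      by (subst openin_subopen) simp
  qed
  have "sigma_compactly_covered X (\<Union>n. F ` B n)"
    by (intro sigma_compactly_covered_UN Menger_space_closed_image reg men closed_B cont) auto
  then obtain \<K> where \<K>: "countable \<K>" "\<forall>K\<in>\<K>. compactin X K \<and> closedin X K" "(\<Union>n. F ` B n) \<subseteq> \<Union>\<K>"
    unfolding sigma_compactly_covered_def by (elim exE conjE)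
  have "topspace X \<subseteq> \<Union>\<K>"
  proof
    fix x assume x: "x \<in> topspace X"
    obtain z where z: "codes X W C z x" using exists_code[of W C, OF W_le_C x] by blast
    then obtain n where n: "z \<in> K n" using K(2) by blast
    \<comment> \<open>The \<open>Suc\<close> keeps a nonzero entry at position 0 distinct from the
      value 0, which marks a vanishing row.\<close>
    define e where "e s = (if \<forall>t. z (prod_encode (s, t)) = 0 then 0
        else Suc (SOME t. z (prod_encode (s, t)) \<noteq> 0))" for s
    have e: "z (prod_encode (s, t)) = 0" if "e s = 0" for s t
      using that by (simp add: e_def split: if_splits)
    have e': "z (prod_encode (s, t)) \<noteq> 0" if "e s = Suc t" for s t
    proof -
      have "\<exists>t. z (prod_encode (s, t)) \<noteq> 0" "t = (SOME t. z (prod_encode (s, t)) \<noteq> 0)"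
        using that by (auto simp: e_def split: if_splits)
      then show ?thesis using someI_ex[of "\<lambda>t. z (prod_encode (s, t)) \<noteq> 0"] by simp
    qed
    define w where "w = interleave z e"
    have w: "w \<in> B n" using n e e' by (auto simp: B_def w_def)
    then obtain L where L: "L \<in> \<K>" "F w \<in> L" using \<K>(3) by blast
    \<comment> \<open>\<open>x\<close> and \<open>F w\<close> share the code \<open>z\<close>;
      closedness of \<open>L\<close> carries membership from \<open>F w\<close> over to
      \<open>x\<close>.\<close>
    have "x \<in> L"
    proof (rule ccontr)
      assume "x \<notin> L"
      moreover have "openin X (topspace X - L)" using \<K>(2) L(1) by blast
      ultimately obtain s where s: "\<forall>t. z (prod_encode (s, t)) = 0"
        and sU: "\<And>z' x'. codes X W C z' x' \<Longrightarrow> \<forall>t. z' (prod_encode (s, t)) = 0 \<Longrightarrow> x' \<in> topspace X - L"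
        using key[OF z, of "topspace X - L"] x by blast
      have "codes X W C z (F w)" using F[OF w] by (simp add: w_def)
      then show False using sU s L(2) by blast
    qed
    then show "x \<in> \<Union>\<K>" using L(1) by blast
  qed
  then have "sigma_compactly_covered X (topspace X)"
    unfolding sigma_compactly_covered_def using \<K> by (intro exI[of _ \<K>]) simp
  then show ?thesis by (rule sigma_compactly_covered_imp_sigma_compact_space)
qed

section \<open>From determinacy of the Wadge game to sigma-compactness\<close>

theorem theorem7p1:
  fixes X :: "'a topology" and A :: "(nat \<Rightarrow> nat) set"
  assumes "sigma_projective_determinacy"
    and "completely_regular_space X"
    and "Menger_space X"
    and "sigma_projective A"
    and "continuous_image_of X A"
  shows "sigma_compact_space X"
proof -
  have reg: "regular_space X" by (rule completely_regular_imp_regular_space) fact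
  obtain f where f: "continuous_map (top_of_set A) X f" "f ` A = topspace X"
    using assms(5) by (auto simp: continuous_image_of_def)
  define N where "N i = f ` (A \<inter> cyl (from_nat i))" for i
  have network: "\<exists>i. x \<in> N i \<and> N i \<subseteq> U" if U: "openin X U" "x \<in> U" for U x
  proof -
    obtain a where a: "a \<in> A" "x = f a" using U openin_subset[OF U(1)] f(2) by blast
    have "openin (top_of_set A) {b \<in> topspace (top_of_set A). f b \<in> U}"
      by (rule openin_continuous_map_preimage[OF f(1) U(1)])
    then obtain O' where O': "open O'" "{b \<in> A. f b \<in> U} = A \<inter> O'"
      by (auto simp: openin_open)
    then have "a \<in> O'" using a U(2) by blast
    then obtain n where n: "cyl (map a [0..<n]) \<subseteq> O'" by (rule open_contains_cyl[OF O'(1)])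
    have "x \<in> N (to_nat (map a [0..<n]))" using a by (simp add: N_def)
    moreover have "N (to_nat (map a [0..<n])) \<subseteq> U" using n O'(2) by (auto simp: N_def)
    ultimately show ?thesis by blast
  qed
  obtain W C :: "nat \<Rightarrow> 'a set" where W: "\<And>p. openin X (W p)" and C: "\<And>p. closedin X (C p)"
    and W_le_C: "\<And>p. W p \<subseteq> C p"
    and sep: "\<And>U x. openin X U \<Longrightarrow> x \<in> U \<Longrightarrow>
       \<exists>s. (\<forall>t. x \<notin> C (prod_encode (s, t))) \<and> topspace X - U \<subseteq> (\<Union>t. W (prod_encode (s, t)))"
    by (rule regular_space_separating_family[OF reg, of N]) (erule (1) network, rule that)
  define Z where "Z = {z. \<exists>x. codes X W C z x}"
  have Z: "Z \<in> projective_class"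
    unfolding Z_def using assms(4) f W C
    by (intro coded_set_in_projective_class) (simp_all add: sigma_projective_iff)
  define P where "P = {v :: baire. infinite {i. v i \<noteq> 0}}"
  have "P = (\<Inter>n. \<Union>i\<in>{n..}. {v. v i \<noteq> 0})"
    by (auto simp: P_def infinite_nat_iff_unbounded_le)
  moreover have "(\<Union>i\<in>{n..}. {v :: baire. v i \<noteq> 0}) \<in> projective_class" for n
    by (intro open_in_projective_class open_UN ballI open_coordinate)
  ultimately have P: "P \<in> projective_class"
    by (simp only:) (intro projective.countable_INT, auto)
  define G where "G = {x. evens x \<in> Z \<longleftrightarrow> odds x \<in> P}"
  have "G = (evens -` Z \<inter> odds -` P) \<union> (- (evens -` Z) \<inter> - (odds -` P))"
    by (auto simp: G_def)
  also have "\<dots> \<in> projective_class"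
    by (intro projective.Un projective.Int projective_class_compl projective_class_vimage
        Z P continuous_on_evens continuous_on_odds)
  finally have "determined G"
    using assms(1) by (simp add: sigma_projective_determinacy_def sigma_projective_iff)
  then consider (I) s where "\<And>x. follows_I s x \<Longrightarrow> x \<in> G" | (II) s where "\<And>x. follows_II s x \<Longrightarrow> x \<notin> G"
    unfolding determined_def by blast
  then show ?thesis
  proof cases
    case I
    obtain \<rho> :: "baire \<Rightarrow> baire" where \<rho>: "\<And>v. follows_I s (\<rho> v)" "\<And>v. odds (\<rho> v) = v"
      and lip: "\<And>v v' k i. \<forall>j<k. v j = v' j \<Longrightarrow> i < k \<Longrightarrow> evens (\<rho> v) i = evens (\<rho> v') i"
      by (rule run_against_I[of s]) (rule that)
    \<comment> \<open>The moves of I against \<open>v\<close> form a Lipschitz reduction of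
      \<open>P\<close> to \<open>Z\<close>.\<close>
    have "(\<exists>x. codes X W C (evens (\<rho> v)) x) \<longleftrightarrow> infinite {i. v i \<noteq> 0}" for v
      using I[OF \<rho>(1)[of v]] \<rho>(2)[of v] by (simp add: G_def Z_def P_def)
    then have False
      by (intro Menger_space_no_reduction[of X W C "\<lambda>v. evens (\<rho> v)"])
        (use assms(3) W C lip in blast)+
    then show ?thesis ..
  next
    case II
    obtain \<rho> :: "baire \<Rightarrow> baire" where \<rho>: "\<And>u. follows_II s (\<rho> u)" "\<And>u. evens (\<rho> u) = u"
      and lip: "\<And>u u' k i. \<forall>j<k. u j = u' j \<Longrightarrow> i < k \<Longrightarrow> odds (\<rho> u) i = odds (\<rho> u') i"
      by (rule run_against_II[of s]) (rule that)
    \<comment> \<open>A real \<open>u\<close> is in \<open>Z\<close> iff the answers of II to it are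
      eventually zero; \<open>n\<close> bounds where the nonzero ones end.\<close>
    define K where "K n = {u. \<forall>m\<ge>n. odds (\<rho> u) m = 0}" for n
    have cont: "continuous_on UNIV (\<lambda>u. odds (\<rho> u))"
      by (rule continuous_on_baireI) (rule lip)
    have closed_K: "closed (K n)" for n
    proof -
      have "K n = (\<Inter>m\<in>{n..}. (\<lambda>u. odds (\<rho> u)) -` {v. v m = 0})"
        by (auto simp: K_def)
      then show ?thesis
        by (simp only:) (intro closed_INT ballI closed_vimage closed_coordinate cont)
    qed
    have Z_eq: "Z = (\<Union>n. K n)"
    proof -
      have "u \<in> Z \<longleftrightarrow> odds (\<rho> u) \<notin> P" for u
        using II[OF \<rho>(1)[of u]] \<rho>(2)[of u] by (simp add: G_def)
      then show ?thesis
        by (auto simp: P_def K_def infinite_nat_iff_unbounded_le)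
    qed
    show ?thesis
      by (rule Menger_space_coded_by_closed_sets[of X W C K])
        (fact reg assms(3) W_le_C sep closed_K Z_eq[unfolded Z_def])+
  qed
qed

end
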